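(* Let $q\in\Bbbk^\times$ with $q\ne\pm1$. Let $B(G,\underline g,\underline\chi)$ be a bosonization of a quantum linear space of rank $\theta$ with $m_i\ne 2$ for all $i$. Suppose $B(G,\underline g,\underline\chi)$ acts on $\mathcal O_q(M_2(\Bbbk))$ with each $g_i$ acting as an element of $\mathcal H\rtimes\langle\tau\rangle$ and each $x_i$ acting linearly and nonzero. Then $\theta\le 3$.
   Context: $\Bbbk$ is an algebraically closed field of characteristic zero; $\operatorname{ord}$ denotes multiplicative order. $\mathcal O_q(M_2(\Bbbk))$ is the algebra generated by $A=Y_{11},B=Y_{12},C=Y_{21},D=Y_{22}$ with relations $AB=qBA$, $AC=qCA$, $BD=qDB$, $CD=qDC$, $BC=CB$, $AD=DA+(q-q^{-1})BC$. $\mathcal H\cong(\Bbbk^\times)^3$ is the group of automorphisms $Y_{ij}\mapsto\alpha_{ij}Y_{ij}$ with $(\alpha_{ij})$ a $2\times2$ matrix of rank one with no zero entries; $\tau$ is the automorphism $Y_{ij}\mapsto Y_{ji}$. Bosonization: let $\theta\in\mathbb N$, $G$ a finite abelian group, $\underline g=(g_1,\dots,g_\theta)$ with $g_i\in G$, and $\underline\chi=(\chi_1,\dots,\chi_\theta)$ with $\chi_i\in\widehat G=\operatorname{Hom}(G,\Bbbk^\times)$, such that $\chi_i(g_j)=\chi_j(g_i)^{-1}$ for $i\ne j$ and $m_i:=\operatorname{ord}(\chi_i(g_i))\ge 2$. Then $B(G,\underline g,\underline\chi)$ is the Hopf algebra generated by $G$ and $x_1,\dots,x_\theta$ with the relations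 of $G$ and $x_i^{m_i}=0$, $x_ix_j=\chi_j(g_i)x_jx_i$ ($i\ne j$), $hx_i=\chi_i(h)x_ih$ ($h\in G$), where elements of $G$ are grouplike and $\Delta(x_i)=g_i\otimes x_i+x_i\otimes1$. Its rank is $\theta$. A Hopf algebra $H$ acts on an algebra $R$ if $R$ is a left $H$-module algebra. "$x_i$ acts linearly and nonzero" means $x_i$ maps $\operatorname{Span}_\Bbbk\{A,B,C,D\}$ into itself and does not act as zero. *)

theory Defs
  imports
    "HOL-Analysis.Cartesian_Space"
    "HOL-Library.Poly_Mapping"
    "HOL-Algebra.Algebra"
    "HOL-Algebra.Algebraic_Closure_Type"
begin

section \<open>Algebras over a field\<close>

text \<open>
  The ground field is a type \<open>'k\<close>; an algebra is a record of type \<open>('k, 'a) module\<close>, the HOL-Algebra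
  ring record extended by a scalar multiplication. (The locale \<open>algebra\<close> of HOL-Algebra covers
  commutative algebras only.)
\<close>

definition k_algebra :: "('k::field, 'a) module \<Rightarrow> bool" where
  "k_algebra A \<longleftrightarrow>
     ring A \<and> module (ring_of_type_algebra :: 'k ring) A \<and>
     (\<forall>c. \<forall>x\<in>carrier A. \<forall>y\<in>carrier A.
        (c \<odot>\<^bsub>A\<^esub> x) \<otimes>\<^bsub>A\<^esub> y = c \<odot>\<^bsub>A\<^esub> (x \<otimes>\<^bsub>A\<^esub> y) \<and>
        x \<otimes>\<^bsub>A\<^esub> (c \<odot>\<^bsub>A\<^esub> y) = c \<odot>\<^bsub>A\<^esub> (x \<otimes>\<^bsub>A\<^esub> y))"

definition base_algebra :: "('k::field, 'k) module" where
  "base_algebra = ring.extend ring_of_type_algebra (module.fields (*))"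

definition lin_map :: "('k::field, 'a) module \<Rightarrow> ('k, 'b) module \<Rightarrow> ('a \<Rightarrow> 'b) set" where
  "lin_map M N = {f \<in> carrier M \<rightarrow> carrier N.
     (\<forall>x\<in>carrier M. \<forall>y\<in>carrier M. f (x \<oplus>\<^bsub>M\<^esub> y) = f x \<oplus>\<^bsub>N\<^esub> f y) \<and>
     (\<forall>c. \<forall>x\<in>carrier M. f (c \<odot>\<^bsub>M\<^esub> x) = c \<odot>\<^bsub>N\<^esub> f x)}"

definition alg_hom :: "('k::field, 'a) module \<Rightarrow> ('k, 'b) module \<Rightarrow> ('a \<Rightarrow> 'b) set" where
  "alg_hom A B = ring_hom A B \<inter> lin_map A B"

text \<open>
  As for \<^const>\<open>auto\<close>, automorphisms are taken to be extensional on the carrier, so that they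
  are elements of the group \<^term>\<open>BijGroup (carrier A)\<close>.
\<close>

definition alg_auto :: "('k::field, 'a) module \<Rightarrow> ('a \<Rightarrow> 'a) set" where
  "alg_auto A = alg_hom A A \<inter> Bij (carrier A)"

definition lin_span :: "('k::field, 'a) module \<Rightarrow> 'a set \<Rightarrow> 'a set" where
  "lin_span M S = {finsum M (\<lambda>s. c s \<odot>\<^bsub>M\<^esub> s) T |c T. finite T \<and> T \<subseteq> S}"


section \<open>Monoid algebras, presentations, tensor products\<close>

text \<open>The monoid algebra \<open>k[M]\<close>: finitely supported functions on \<open>M\<close> with convolution.\<close>

definition monoid_algebra :: "('m, 'z) monoid_scheme \<Rightarrow> ('k::field, 'm \<Rightarrow>\<^sub>0 'k) module" where
  "monoid_algebra M =
     \<lparr>carrier = {p. Poly_Mapping.keys p \<subseteq> carrier M},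
      monoid.mult = (\<lambda>p r. \<Sum>s\<in>Poly_Mapping.keys p. \<Sum>t\<in>Poly_Mapping.keys r.
                Poly_Mapping.single (s \<otimes>\<^bsub>M\<^esub> t) (Poly_Mapping.lookup p s * Poly_Mapping.lookup r t)),
      one = Poly_Mapping.single \<one>\<^bsub>M\<^esub> 1,
      ring.zero = 0,
      ring.add = (+),
      module.smult = (\<lambda>c. Poly_Mapping.map ((*) c))\<rparr>"

text \<open>The quotient of \<open>F\<close> by the two-sided ideal generated by \<open>R\<close>, and its projection.\<close>

definition quot_algebra :: "('k::field, 'a) module \<Rightarrow> 'a set \<Rightarrow> ('k, 'a set) module" where
  "quot_algebra F R =
     ring.extend (F Quot (Idl\<^bsub>F\<^esub> R))
       (module.fields (\<lambda>c U. \<Union>u\<in>U. (Idl\<^bsub>F\<^esub> R) +>\<^bsub>F\<^esub> (c \<odot>\<^bsub>F\<^esub> u)))"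

definition quot_proj :: "('k::field, 'a) module \<Rightarrow> 'a set \<Rightarrow> 'a \<Rightarrow> 'a set" where
  "quot_proj F R u = (Idl\<^bsub>F\<^esub> R) +>\<^bsub>F\<^esub> u"

definition free_monoid :: "'x set \<Rightarrow> 'x list monoid" where
  "free_monoid V = \<lparr>carrier = lists V, monoid.mult = (@), one = []\<rparr>"

abbreviation free_algebra :: "'x set \<Rightarrow> ('k::field, 'x list \<Rightarrow>\<^sub>0 'k) module" where
  "free_algebra V \<equiv> monoid_algebra (free_monoid V)"

text \<open>The algebra with generators \<open>V\<close> and relations \<open>r = 0\<close> for \<open>r \<in> R\<close>.\<close>

definition presented_algebra ::
    "'x set \<Rightarrow> ('x list \<Rightarrow>\<^sub>0 'k::field) set \<Rightarrow> ('k, ('x list \<Rightarrow>\<^sub>0 'k) set) module" where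
  "presented_algebra V R = quot_algebra (free_algebra V) R"

definition presented_gen ::
    "'x set \<Rightarrow> ('x list \<Rightarrow>\<^sub>0 'k::field) set \<Rightarrow> 'x \<Rightarrow> ('x list \<Rightarrow>\<^sub>0 'k) set" where
  "presented_gen V R x = quot_proj (free_algebra V) R (Poly_Mapping.single [x] 1)"

text \<open>
  \<open>A \<otimes> B\<close> is the vector space with basis \<open>A \<times> B\<close> modulo the bilinearity relations. With the product
  \<open>(a, b) (a', b') = (a a', b b')\<close> on this basis (the monoid algebra of \<open>A \<times> B\<close>), the span of these
  relations is already an ideal, so the quotient by the ideal they generate is the usual tensor
  product algebra. An element of \<open>A \<otimes> B\<close> is thus the set of its representatives
  \<open>\<Sum> c\<^sub>i (a\<^sub>i, b\<^sub>i)\<close>.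
\<close>

definition bilinear_rels ::
    "('k::field, 'a) module \<Rightarrow> ('k, 'b) module \<Rightarrow> ('a \<times> 'b \<Rightarrow>\<^sub>0 'k) set" where
  "bilinear_rels A B =
     {Poly_Mapping.single (a \<oplus>\<^bsub>A\<^esub> a', b) 1 - Poly_Mapping.single (a, b) 1
        - Poly_Mapping.single (a', b) 1
      |a a' b. a \<in> carrier A \<and> a' \<in> carrier A \<and> b \<in> carrier B} \<union>
     {Poly_Mapping.single (a, b \<oplus>\<^bsub>B\<^esub> b') 1 - Poly_Mapping.single (a, b) 1
        - Poly_Mapping.single (a, b') 1
      |a b b'. a \<in> carrier A \<and> b \<in> carrier B \<and> b' \<in> carrier B} \<union>
     {Poly_Mapping.single (c \<odot>\<^bsub>A\<^esub> a, b) 1 - Poly_Mapping.single (a, b) c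
      |c a b. a \<in> carrier A \<and> b \<in> carrier B} \<union>
     {Poly_Mapping.single (a, c \<odot>\<^bsub>B\<^esub> b) 1 - Poly_Mapping.single (a, b) c
      |c a b. a \<in> carrier A \<and> b \<in> carrier B}"

definition tensor_algebra ::
    "('k::field, 'a) module \<Rightarrow> ('k, 'b) module \<Rightarrow> ('k, ('a \<times> 'b \<Rightarrow>\<^sub>0 'k) set) module" where
  "tensor_algebra A B = quot_algebra (monoid_algebra (A \<times>\<times> B)) (bilinear_rels A B)"

definition pure_tensor ::
    "('k::field, 'a) module \<Rightarrow> ('k, 'b) module \<Rightarrow> 'a \<Rightarrow> 'b \<Rightarrow> ('a \<times> 'b \<Rightarrow>\<^sub>0 'k) set" where
  "pure_tensor A B a b =
     quot_proj (monoid_algebra (A \<times>\<times> B)) (bilinear_rels A B) (Poly_Mapping.single (a, b) 1)"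

text \<open>
  \<open>sweedler W \<beta> p = \<Sum> c\<^sub>i \<beta>(a\<^sub>i, b\<^sub>i)\<close> in \<open>W\<close> for a representative \<open>p = \<Sum> c\<^sub>i (a\<^sub>i, b\<^sub>i)\<close> of a tensor; for
  bilinear \<open>\<beta>\<close> this depends on the tensor only.
\<close>

definition sweedler ::
    "('k::field, 'w) module \<Rightarrow> ('a \<Rightarrow> 'b \<Rightarrow> 'w) \<Rightarrow> ('a \<times> 'b \<Rightarrow>\<^sub>0 'k) \<Rightarrow> 'w" where
  "sweedler W \<beta> p =
     finsum W (\<lambda>s. Poly_Mapping.lookup p s \<odot>\<^bsub>W\<^esub> \<beta> (fst s) (snd s)) (Poly_Mapping.keys p)"


section \<open>Hopf algebras and module algebras\<close>

text \<open>
  In the coassociativity axiom \<open>r b\<close> is a representative of \<open>\<Delta> b\<close>; both sides are compared in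
  \<open>(H \<otimes> H) \<otimes> H\<close>. The last conjunct is the existence of an antipode.
\<close>

definition hopf_algebra ::
    "('k::field, 'h) module \<Rightarrow> ('h \<Rightarrow> ('h \<times> 'h \<Rightarrow>\<^sub>0 'k) set) \<Rightarrow> ('h \<Rightarrow> 'k) \<Rightarrow> bool" where
  "hopf_algebra H \<Delta> \<epsilon> \<longleftrightarrow>
     k_algebra H \<and>
     \<Delta> \<in> alg_hom H (tensor_algebra H H) \<and>
     \<epsilon> \<in> alg_hom H base_algebra \<and>
     (\<forall>h\<in>carrier H. \<forall>p\<in>\<Delta> h. \<forall>r. (\<forall>b\<in>carrier H. r b \<in> \<Delta> b) \<longrightarrow>
        sweedler (tensor_algebra (tensor_algebra H H) H)
          (\<lambda>a b. pure_tensor (tensor_algebra H H) H (\<Delta> a) b) p =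
        sweedler (tensor_algebra (tensor_algebra H H) H)
          (\<lambda>a b. sweedler (tensor_algebra (tensor_algebra H H) H)
             (\<lambda>u v. pure_tensor (tensor_algebra H H) H (pure_tensor H H a u) v) (r b)) p) \<and>
     (\<forall>h\<in>carrier H. \<forall>p\<in>\<Delta> h.
        sweedler H (\<lambda>a b. \<epsilon> a \<odot>\<^bsub>H\<^esub> b) p = h \<and>
        sweedler H (\<lambda>a b. \<epsilon> b \<odot>\<^bsub>H\<^esub> a) p = h) \<and>
     (\<exists>S\<in>lin_map H H. \<forall>h\<in>carrier H. \<forall>p\<in>\<Delta> h.
        sweedler H (\<lambda>a b. S a \<otimes>\<^bsub>H\<^esub> b) p = \<epsilon> h \<odot>\<^bsub>H\<^esub> \<one>\<^bsub>H\<^esub> \<and>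
        sweedler H (\<lambda>a b. a \<otimes>\<^bsub>H\<^esub> S b) p = \<epsilon> h \<odot>\<^bsub>H\<^esub> \<one>\<^bsub>H\<^esub>)"

definition module_algebra ::
    "('k::field, 'h) module \<Rightarrow> ('h \<Rightarrow> ('h \<times> 'h \<Rightarrow>\<^sub>0 'k) set) \<Rightarrow> ('h \<Rightarrow> 'k) \<Rightarrow>
     ('k, 'r) module \<Rightarrow> ('h \<Rightarrow> 'r \<Rightarrow> 'r) \<Rightarrow> bool" where
  "module_algebra H \<Delta> \<epsilon> R act \<longleftrightarrow>
     k_algebra R \<and>
     (\<forall>h\<in>carrier H. act h \<in> lin_map R R) \<and>
     (\<forall>a\<in>carrier R. (\<lambda>h. act h a) \<in> lin_map H R) \<and>
     (\<forall>a\<in>carrier R. act \<one>\<^bsub>H\<^esub> a = a) \<and>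
     (\<forall>h\<in>carrier H. \<forall>h'\<in>carrier H. \<forall>a\<in>carrier R. act (h \<otimes>\<^bsub>H\<^esub> h') a = act h (act h' a)) \<and>
     (\<forall>h\<in>carrier H. \<forall>p\<in>\<Delta> h. \<forall>a\<in>carrier R. \<forall>b\<in>carrier R.
        act h (a \<otimes>\<^bsub>R\<^esub> b) = sweedler R (\<lambda>u v. act u a \<otimes>\<^bsub>R\<^esub> act v b) p) \<and>
     (\<forall>h\<in>carrier H. act h \<one>\<^bsub>R\<^esub> = \<epsilon> h \<odot>\<^bsub>R\<^esub> \<one>\<^bsub>R\<^esub>)"


section \<open>Bosonizations of quantum linear spaces\<close>

abbreviation mult_group :: "'k::field monoid" where
  "mult_group \<equiv> units_of (ring_of_type_algebra :: 'k ring)"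

text \<open>\<open>m\<^sub>i = ord(chi\<^sub>i(g\<^sub>i))\<close>; \<^const>\<open>group.ord\<close> is 0 for elements of infinite order.\<close>

definition qls_order :: "(nat \<Rightarrow> 'g) \<Rightarrow> (nat \<Rightarrow> 'g \<Rightarrow> 'k::field) \<Rightarrow> nat \<Rightarrow> nat" where
  "qls_order g chi i = group.ord mult_group (chi i (g i))"

definition qls_datum ::
    "('g, 'z) monoid_scheme \<Rightarrow> nat \<Rightarrow> (nat \<Rightarrow> 'g) \<Rightarrow> (nat \<Rightarrow> 'g \<Rightarrow> 'k::field) \<Rightarrow> bool" where
  "qls_datum G \<theta> g chi \<longleftrightarrow>
     comm_group G \<and> finite (carrier G) \<and>
     (\<forall>i\<in>{1..\<theta>}. g i \<in> carrier G \<and> chi i \<in> hom G mult_group \<and> qls_order g chi i \<ge> 2) \<and>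
     (\<forall>i\<in>{1..\<theta>}. \<forall>j\<in>{1..\<theta>}. i \<noteq> j \<longrightarrow> chi i (g j) = inverse (chi j (g i)))"

datatype 'g bos_gen = Grp 'g | Skew nat

definition bos_gens :: "('g, 'z) monoid_scheme \<Rightarrow> nat \<Rightarrow> 'g bos_gen set" where
  "bos_gens G \<theta> = Grp ` carrier G \<union> Skew ` {1..\<theta>}"

definition bos_rels ::
    "('g, 'z) monoid_scheme \<Rightarrow> nat \<Rightarrow> (nat \<Rightarrow> 'g) \<Rightarrow> (nat \<Rightarrow> 'g \<Rightarrow> 'k::field) \<Rightarrow>
     ('g bos_gen list \<Rightarrow>\<^sub>0 'k) set" where
  "bos_rels G \<theta> g chi =
     {Poly_Mapping.single [Grp h, Grp h'] 1 - Poly_Mapping.single [Grp (h \<otimes>\<^bsub>G\<^esub> h')] 1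
      |h h'. h \<in> carrier G \<and> h' \<in> carrier G} \<union>
     {Poly_Mapping.single [Grp \<one>\<^bsub>G\<^esub>] 1 - Poly_Mapping.single [] 1} \<union>
     {Poly_Mapping.single (replicate (qls_order g chi i) (Skew i)) 1 |i. i \<in> {1..\<theta>}} \<union>
     {Poly_Mapping.single [Skew i, Skew j] 1 - Poly_Mapping.single [Skew j, Skew i] (chi j (g i))
      |i j. i \<in> {1..\<theta>} \<and> j \<in> {1..\<theta>} \<and> i \<noteq> j} \<union>
     {Poly_Mapping.single [Grp h, Skew i] 1 - Poly_Mapping.single [Skew i, Grp h] (chi i h)
      |h i. h \<in> carrier G \<and> i \<in> {1..\<theta>}}"

definition bos_alg ::
    "('g, 'z) monoid_scheme \<Rightarrow> nat \<Rightarrow> (nat \<Rightarrow> 'g) \<Rightarrow> (nat \<Rightarrow> 'g \<Rightarrow> 'k::field) \<Rightarrow>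
     ('k, ('g bos_gen list \<Rightarrow>\<^sub>0 'k) set) module" where
  "bos_alg G \<theta> g chi = presented_algebra (bos_gens G \<theta>) (bos_rels G \<theta> g chi)"

definition bos_grp ::
    "('g, 'z) monoid_scheme \<Rightarrow> nat \<Rightarrow> (nat \<Rightarrow> 'g) \<Rightarrow> (nat \<Rightarrow> 'g \<Rightarrow> 'k::field) \<Rightarrow>
     'g \<Rightarrow> ('g bos_gen list \<Rightarrow>\<^sub>0 'k) set" where
  "bos_grp G \<theta> g chi h = presented_gen (bos_gens G \<theta>) (bos_rels G \<theta> g chi) (Grp h)"

definition bos_x ::
    "('g, 'z) monoid_scheme \<Rightarrow> nat \<Rightarrow> (nat \<Rightarrow> 'g) \<Rightarrow> (nat \<Rightarrow> 'g \<Rightarrow> 'k::field) \<Rightarrow>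
     nat \<Rightarrow> ('g bos_gen list \<Rightarrow>\<^sub>0 'k) set" where
  "bos_x G \<theta> g chi i = presented_gen (bos_gens G \<theta>) (bos_rels G \<theta> g chi) (Skew i)"

text \<open>
  \<open>\<Delta>\<close> and \<open>\<epsilon>\<close> are the Hopf algebra structure of \<open>B(G, g, chi)\<close>. The conditions determine both maps on
  the carrier: \<open>\<Delta>\<close> is an algebra homomorphism prescribed on generators, and the counit axiom forces
  \<open>\<epsilon>(h) = 1\<close> and \<open>\<epsilon>(x\<^sub>i) = 0\<close>.
\<close>

definition bosonization ::
    "('g, 'z) monoid_scheme \<Rightarrow> nat \<Rightarrow> (nat \<Rightarrow> 'g) \<Rightarrow> (nat \<Rightarrow> 'g \<Rightarrow> 'k::field) \<Rightarrow>
     (('g bos_gen list \<Rightarrow>\<^sub>0 'k) set \<Rightarrow>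
       (('g bos_gen list \<Rightarrow>\<^sub>0 'k) set \<times> ('g bos_gen list \<Rightarrow>\<^sub>0 'k) set \<Rightarrow>\<^sub>0 'k) set) \<Rightarrow>
     (('g bos_gen list \<Rightarrow>\<^sub>0 'k) set \<Rightarrow> 'k) \<Rightarrow> bool" where
  "bosonization G \<theta> g chi \<Delta> \<epsilon> \<longleftrightarrow>
     qls_datum G \<theta> g chi \<and>
     (let B = bos_alg G \<theta> g chi; \<gamma> = bos_grp G \<theta> g chi; x = bos_x G \<theta> g chi in
        hopf_algebra B \<Delta> \<epsilon> \<and>
        (\<forall>h\<in>carrier G. \<Delta> (\<gamma> h) = pure_tensor B B (\<gamma> h) (\<gamma> h)) \<and>
        (\<forall>i\<in>{1..\<theta>}. \<Delta> (x i) =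
           pure_tensor B B (\<gamma> (g i)) (x i) \<oplus>\<^bsub>tensor_algebra B B\<^esub> pure_tensor B B (x i) \<one>\<^bsub>B\<^esub>))"


section \<open>Quantum two by two matrices\<close>

text \<open>
  The letter \<open>(i, j)\<close> stands for \<open>Y\<^sub>i\<^sub>j\<close>; the index type \<open>2\<close> consists of \<open>1\<close> and
  \<open>2\<close> (with \<open>2 = 0\<close>).
\<close>

definition oqm2_rels :: "'k::field \<Rightarrow> ((2 \<times> 2) list \<Rightarrow>\<^sub>0 'k) set" where
  "oqm2_rels q =
     (let A = (1, 1); B = (1, 2); C = (2, 1); D = (2, 2);
          w = (\<lambda>s t. Poly_Mapping.single [s, t] :: 'k \<Rightarrow> _)
      in {w A B 1 - w B A q,
          w A C 1 - w C A q,
          w B D 1 - w D B q,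
          w C D 1 - w D C q,
          w B C 1 - w C B 1,
          w A D 1 - (w D A 1 + w B C (q - inverse q))})"

definition oqm2 :: "'k::field \<Rightarrow> ('k, ((2 \<times> 2) list \<Rightarrow>\<^sub>0 'k) set) module" where
  "oqm2 q = presented_algebra UNIV (oqm2_rels q)"

definition oqm2_Y :: "'k::field \<Rightarrow> 2 \<Rightarrow> 2 \<Rightarrow> ((2 \<times> 2) list \<Rightarrow>\<^sub>0 'k) set" where
  "oqm2_Y q i j = presented_gen UNIV (oqm2_rels q) (i, j)"

definition oqm2_torus ::
    "'k::field \<Rightarrow> (((2 \<times> 2) list \<Rightarrow>\<^sub>0 'k) set \<Rightarrow> ((2 \<times> 2) list \<Rightarrow>\<^sub>0 'k) set) set" where
  "oqm2_torus q = {\<phi> \<in> alg_auto (oqm2 q).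
     \<exists>\<alpha> :: 'k^2^2. rank \<alpha> = 1 \<and> (\<forall>i j. \<alpha> $ i $ j \<noteq> 0) \<and>
       (\<forall>i j. \<phi> (oqm2_Y q i j) = \<alpha> $ i $ j \<odot>\<^bsub>oqm2 q\<^esub> oqm2_Y q i j)}"

text \<open>The singleton of the transposition automorphism \<open>\<tau>\<close>.\<close>

definition oqm2_transp ::
    "'k::field \<Rightarrow> (((2 \<times> 2) list \<Rightarrow>\<^sub>0 'k) set \<Rightarrow> ((2 \<times> 2) list \<Rightarrow>\<^sub>0 'k) set) set" where
  "oqm2_transp q = {\<tau> \<in> alg_auto (oqm2 q). \<forall>i j. \<tau> (oqm2_Y q i j) = oqm2_Y q j i}"

text \<open>The internal semidirect product of the torus and the group generated by \<open>\<tau>\<close>.\<close>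

definition oqm2_torus_transp ::
    "'k::field \<Rightarrow> (((2 \<times> 2) list \<Rightarrow>\<^sub>0 'k) set \<Rightarrow> ((2 \<times> 2) list \<Rightarrow>\<^sub>0 'k) set) set" where
  "oqm2_torus_transp q =
     oqm2_torus q <#>\<^bsub>BijGroup (carrier (oqm2 q))\<^esub>
       generate (BijGroup (carrier (oqm2 q))) (oqm2_transp q)"

definition oqm2_linear_span :: "'k::field \<Rightarrow> ((2 \<times> 2) list \<Rightarrow>\<^sub>0 'k) set set" where
  "oqm2_linear_span q = lin_span (oqm2 q) {oqm2_Y q i j |i j. True}"

end

theory Submission
  imports Defs
begin

text \<open>
  Let \<open>V\<close> be the span of the generators \<open>A, B, C, D\<close>. Each \<open>g\<^sub>i\<close> acts on \<open>V\<close> by a diagonal matrix,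
  possibly after exchanging \<open>B\<close> and \<open>C\<close>, and each \<open>x\<^sub>i\<close> acts on \<open>V\<close> by some matrix. Since
  \<open>x\<^sub>i(ab) = g\<^sub>i(a) x\<^sub>i(b) + x\<^sub>i(a) b\<close> and \<open>x\<^sub>i(1) = 0\<close>, the action of \<open>x\<^sub>i\<close> is determined by its
  matrix, which is therefore nonzero. So the theorem is a question about \<open>4 \<times> 4\<close> matrices.

  The matrices satisfy two sorts of equations. Applying \<open>x\<^sub>i\<close> to the six defining relations gives
  elements of degree two that vanish in the algebra. The part of degree two of the ideal of
  relations is no larger than the span of the relations (\<open>oqm2_proj_quad_eq_zero_iff\<close>), so every
  such element gives ten linear equations. Secondly, \<open>g\<^sub>i x\<^sub>j = \<chi>\<^sub>j(g\<^sub>i) x\<^sub>j g\<^sub>i\<close>. For \<open>i = j\<close> this says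
  that \<open>x\<^sub>i\<close> multiplies weights of \<open>g\<^sub>i\<close> by \<open>\<lambda>\<^sub>i = \<chi>\<^sub>i(g\<^sub>i)\<close>, an element of order greater than two.

  These equations exclude that \<open>g\<^sub>i\<close> exchanges \<open>B\<close> and \<open>C\<close>
  (\<open>twisted_skew_derivation_eq_0\<close>), and they leave five kinds of operators \<open>x\<^sub>i\<close>
  (\<open>diagonal_skew_derivation_kind\<close>): a shift of the two columns (\<open>A \<mapsto> B, C \<mapsto> D\<close> or backwards), a
  shift of the two rows, a map that takes \<open>A\<close> to a multiple of \<open>D\<close> or \<open>D\<close> to a multiple of \<open>A\<close>, a
  map that takes \<open>A\<close> into the span of \<open>B, C\<close>, and one that does the same with \<open>D\<close>. For each of
  them \<open>\<lambda>\<^sub>i\<close> is \<open>q\<^sup>2\<close>, \<open>q\<^sup>4\<close> or an inverse of these.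

  Finally two different operators satisfy \<open>x\<^sub>i x\<^sub>j = \<chi>\<^sub>j(g\<^sub>i) x\<^sub>j x\<^sub>i\<close>. If both have a nonzero entry at
  the same place, the weights give \<open>\<lambda>\<^sub>i \<lambda>\<^sub>j = 1\<close>, whereas operators of one kind with the same
  direction have \<open>\<lambda>\<^sub>i = \<lambda>\<^sub>j\<close>; for opposite directions only one of the compositions sends \<open>A\<close> to a
  nonzero multiple of itself. So each kind occurs at most once (\<open>same_kind_False\<close>). Comparing the
  two compositions also shows that three particular triples of kinds cannot occur together. Any four
  of the five kinds contain one of these triples, hence at most three operators exist
  (\<open>pairwise_skew_bound\<close>).
\<close>

section \<open>Monoid algebras and their quotients\<close>

text \<open>
  Reduces an identity that is additive in each argument to monomials whose exponents lie in the
  carrier.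
\<close>

lemma poly_mapping_keys_induct [consumes 1, case_names zero add]:
  fixes p :: "'m \<Rightarrow>\<^sub>0 'k::comm_monoid_add"
  assumes keys: "Poly_Mapping.keys p \<subseteq> S" and zero: "P 0"
    and add: "\<And>s c r. s \<in> S \<Longrightarrow> P r \<Longrightarrow> P (Poly_Mapping.single s c + r)"
  shows "P p"
proof -
  have "T \<subseteq> S \<Longrightarrow> P (\<Sum>s\<in>T. Poly_Mapping.single s (Poly_Mapping.lookup p s))" if "finite T" for T
    using that by (induction T) (auto intro: zero add)
  moreover have "(\<Sum>s\<in>Poly_Mapping.keys p. Poly_Mapping.single s (Poly_Mapping.lookup p s)) = p"
    by (rule poly_mapping_eqI) (simp add: lookup_sum lookup_single when_def in_keys_iff)
  ultimately show ?thesis using keys by (metis finite_keys)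
qed

lemma lookup_scale: "Poly_Mapping.lookup (Poly_Mapping.map ((*) c) p) s = c * Poly_Mapping.lookup p s"
  for c :: "'k::field"
  by (simp add: Poly_Mapping.map.rep_eq when_def)

lemma map_scale_add: "Poly_Mapping.map ((*) c) (p + r) = Poly_Mapping.map ((*) c) p + Poly_Mapping.map ((*) c) r"
  for c :: "'k::field"
  by (rule poly_mapping_eqI) (simp add: lookup_scale lookup_add distrib_left)

lemma map_scale_zero: "Poly_Mapping.map ((*) c) 0 = 0" for c :: "'k::field"
  by (rule poly_mapping_eqI) (simp add: lookup_scale)

lemma map_scale_sum: "Poly_Mapping.map ((*) a) (\<Sum>s\<in>S. p s) = (\<Sum>s\<in>S. Poly_Mapping.map ((*) a) (p s))"
  for a :: "'k::field"
  by (rule poly_mapping_eqI) (simp add: lookup_scale lookup_sum sum_distrib_left)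

lemma map_scale_single: "Poly_Mapping.map ((*) a) (Poly_Mapping.single s b) = Poly_Mapping.single s (a * b)"
  for a :: "'k::field"
  by (rule poly_mapping_eqI) (simp add: lookup_scale lookup_single when_def)

context
  fixes M :: "('m, 'z) monoid_scheme"
begin

abbreviation MA :: "('k::field, 'm \<Rightarrow>\<^sub>0 'k) module" where "MA \<equiv> monoid_algebra M"

lemma monoid_algebra_simps:
  "carrier MA = {p. Poly_Mapping.keys p \<subseteq> carrier M}"
  "\<one>\<^bsub>MA\<^esub> = Poly_Mapping.single \<one>\<^bsub>M\<^esub> 1"
  "\<zero>\<^bsub>MA\<^esub> = 0"
  "p \<oplus>\<^bsub>MA\<^esub> r = p + r"
  "c \<odot>\<^bsub>MA\<^esub> p = Poly_Mapping.map ((*) c) p"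
  by (simp_all add: monoid_algebra_def)

text \<open>
  Summation over the supports makes the product hard to compare for different factors. Over larger
  index sets the coefficients are additive in each factor, which gives distributivity.
\<close>

lemma monoid_algebra_mult_superset:
  assumes "finite S" "Poly_Mapping.keys p \<subseteq> S" "finite T" "Poly_Mapping.keys r \<subseteq> T"
  shows "p \<otimes>\<^bsub>MA\<^esub> r = (\<Sum>s\<in>S. \<Sum>t\<in>T.
    Poly_Mapping.single (s \<otimes>\<^bsub>M\<^esub> t) (Poly_Mapping.lookup p s * Poly_Mapping.lookup r t))"
proof -
  have "p \<otimes>\<^bsub>MA\<^esub> r = (\<Sum>s\<in>Poly_Mapping.keys p. \<Sum>t\<in>T.
    Poly_Mapping.single (s \<otimes>\<^bsub>M\<^esub> t) (Poly_Mapping.lookup p s * Poly_Mapping.lookup r t))"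
    unfolding monoid_algebra_def
    by (simp, intro sum.cong refl sum.mono_neutral_left) (use assms in \<open>auto simp: in_keys_iff\<close>)
  also have "\<dots> = (\<Sum>s\<in>S. \<Sum>t\<in>T.
    Poly_Mapping.single (s \<otimes>\<^bsub>M\<^esub> t) (Poly_Mapping.lookup p s * Poly_Mapping.lookup r t))"
    by (intro sum.mono_neutral_left) (use assms in \<open>auto simp: in_keys_iff\<close>)
  finally show ?thesis .
qed

lemma monoid_algebra_mult_zero: "0 \<otimes>\<^bsub>MA\<^esub> r = 0" "p \<otimes>\<^bsub>MA\<^esub> 0 = 0"
  by (simp_all add: monoid_algebra_def)

lemma monoid_algebra_mult_single:
  "Poly_Mapping.single s c \<otimes>\<^bsub>MA\<^esub> Poly_Mapping.single t d = Poly_Mapping.single (s \<otimes>\<^bsub>M\<^esub> t) (c * d)"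
  by (subst monoid_algebra_mult_superset[where S = "{s}" and T = "{t}"]) auto

lemma monoid_algebra_distrib_right:
  "(p + p') \<otimes>\<^bsub>MA\<^esub> r = p \<otimes>\<^bsub>MA\<^esub> r + p' \<otimes>\<^bsub>MA\<^esub> r"
proof -
  let ?S = "Poly_Mapping.keys p \<union> Poly_Mapping.keys p'"
  note m = monoid_algebra_mult_superset[where S = ?S and T = "Poly_Mapping.keys r"]
  show ?thesis
    by (simp add: m Poly_Mapping.keys_add lookup_add distrib_right single_add sum.distrib)
qed

lemma monoid_algebra_distrib_left:
  "p \<otimes>\<^bsub>MA\<^esub> (r + r') = p \<otimes>\<^bsub>MA\<^esub> r + p \<otimes>\<^bsub>MA\<^esub> r'"
proof -
  let ?T = "Poly_Mapping.keys r \<union> Poly_Mapping.keys r'"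
  note m = monoid_algebra_mult_superset[where S = "Poly_Mapping.keys p" and T = ?T]
  show ?thesis
    by (simp add: m Poly_Mapping.keys_add lookup_add distrib_left single_add sum.distrib)
qed

lemma monoid_algebra_mult_closed:
  fixes p r :: "'m \<Rightarrow>\<^sub>0 'k::field"
  assumes M: "monoid M" and "p \<in> carrier MA" "r \<in> carrier MA"
  shows "p \<otimes>\<^bsub>MA\<^esub> r \<in> carrier MA"
proof -
  have sum: "Poly_Mapping.keys (\<Sum>s\<in>S. f s) \<subseteq> carrier M"
    if "\<And>s. s \<in> S \<Longrightarrow> Poly_Mapping.keys (f s) \<subseteq> carrier M" for S :: "'m set" and f :: "'m \<Rightarrow> 'm \<Rightarrow>\<^sub>0 'k"
    using that
  proof (induction S rule: infinite_finite_induct)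
    case (insert s S)
    then show ?case using Poly_Mapping.keys_add[of "f s" "sum f S"] by (simp, blast)
  qed auto
  show ?thesis
    using assms(2,3) unfolding monoid_algebra_def
    by (simp, intro sum) (auto split: if_splits intro: monoid.m_closed[OF M])
qed

lemma monoid_algebra_assoc:
  fixes p r u :: "'m \<Rightarrow>\<^sub>0 'k::field"
  assumes M: "monoid M" and p: "p \<in> carrier MA" and r: "r \<in> carrier MA" and u: "u \<in> carrier MA"
  shows "(p \<otimes>\<^bsub>MA\<^esub> r) \<otimes>\<^bsub>MA\<^esub> u = p \<otimes>\<^bsub>MA\<^esub> (r \<otimes>\<^bsub>MA\<^esub> u)"
proof -
  note distribs = monoid_algebra_distrib_left monoid_algebra_distrib_right
    monoid_algebra_mult_zero monoid_algebra_mult_single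
  have keys: "Poly_Mapping.keys p \<subseteq> carrier M" "Poly_Mapping.keys r \<subseteq> carrier M"
    "Poly_Mapping.keys u \<subseteq> carrier M"
    using p r u by (auto simp: monoid_algebra_simps)
  have single: "(Poly_Mapping.single s c \<otimes>\<^bsub>MA\<^esub> Poly_Mapping.single t d) \<otimes>\<^bsub>MA\<^esub> u =
      Poly_Mapping.single s c \<otimes>\<^bsub>MA\<^esub> (Poly_Mapping.single t d \<otimes>\<^bsub>MA\<^esub> u)"
    if "s \<in> carrier M" "t \<in> carrier M" for s t :: 'm and c d :: 'k
    using keys(3)
    by (induction u rule: poly_mapping_keys_induct)
      (use that in \<open>simp_all add: distribs monoid.m_assoc[OF M] mult.assoc\<close>)
  have "(Poly_Mapping.single s c \<otimes>\<^bsub>MA\<^esub> r) \<otimes>\<^bsub>MA\<^esub> u = Poly_Mapping.single s c \<otimes>\<^bsub>MA\<^esub> (r \<otimes>\<^bsub>MA\<^esub> u)"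
    if "s \<in> carrier M" for s c
    using keys(2)
    by (induction r rule: poly_mapping_keys_induct)
      (use that single in \<open>simp_all add: distribs(1-4)\<close>)
  note single' = this
  show ?thesis
    using keys(1)
    by (induction p rule: poly_mapping_keys_induct) (simp_all add: single' distribs(1-4))
qed

lemma ring_monoid_algebra:
  assumes M: "monoid M"
  shows "ring (MA :: ('k::field, 'm \<Rightarrow>\<^sub>0 'k) module)"
proof (rule ringI)
  show "abelian_group (MA :: ('k, 'm \<Rightarrow>\<^sub>0 'k) module)"
  proof (rule abelian_groupI)
    fix x :: "'m \<Rightarrow>\<^sub>0 'k" assume x: "x \<in> carrier MA"
    show "\<exists>y\<in>carrier MA. y \<oplus>\<^bsub>MA\<^esub> x = \<zero>\<^bsub>MA\<^esub>"
    proof (rule bexI)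
      show "- x \<oplus>\<^bsub>MA\<^esub> x = \<zero>\<^bsub>MA\<^esub>" by (simp add: monoid_algebra_simps)
      show "- x \<in> carrier MA" using x by (auto simp: monoid_algebra_simps in_keys_iff)
    qed
    show "\<zero>\<^bsub>MA\<^esub> \<oplus>\<^bsub>MA\<^esub> x = x" by (simp add: monoid_algebra_simps)
    fix y :: "'m \<Rightarrow>\<^sub>0 'k" assume y: "y \<in> carrier MA"
    show "x \<oplus>\<^bsub>MA\<^esub> y \<in> carrier MA"
      using x y Poly_Mapping.keys_add[of x y] by (auto simp: monoid_algebra_simps)
    show "x \<oplus>\<^bsub>MA\<^esub> y = y \<oplus>\<^bsub>MA\<^esub> x" by (simp add: monoid_algebra_simps add.commute)
    fix z :: "'m \<Rightarrow>\<^sub>0 'k"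
    show "x \<oplus>\<^bsub>MA\<^esub> y \<oplus>\<^bsub>MA\<^esub> z = x \<oplus>\<^bsub>MA\<^esub> (y \<oplus>\<^bsub>MA\<^esub> z)" by (simp add: monoid_algebra_simps add.assoc)
  qed (simp add: monoid_algebra_simps)
  show "monoid (MA :: ('k, 'm \<Rightarrow>\<^sub>0 'k) module)"
  proof (rule monoidI)
    fix x :: "'m \<Rightarrow>\<^sub>0 'k" assume "x \<in> carrier MA"
    then have keys: "Poly_Mapping.keys x \<subseteq> carrier M" by (simp add: monoid_algebra_simps)
    show "\<one>\<^bsub>MA\<^esub> \<otimes>\<^bsub>MA\<^esub> x = x"
      using keys by (induction x rule: poly_mapping_keys_induct)
        (simp_all add: monoid_algebra_simps(2) monoid_algebra_distrib_left monoid_algebra_mult_zero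
           monoid_algebra_mult_single monoid.l_one[OF M])
    show "x \<otimes>\<^bsub>MA\<^esub> \<one>\<^bsub>MA\<^esub> = x"
      using keys by (induction x rule: poly_mapping_keys_induct)
        (simp_all add: monoid_algebra_simps(2) monoid_algebra_distrib_right monoid_algebra_mult_zero
           monoid_algebra_mult_single monoid.r_one[OF M])
  qed (simp_all add: monoid_algebra_mult_closed[OF M] monoid_algebra_assoc[OF M],
       simp add: monoid_algebra_simps monoid.one_closed[OF M])
qed (simp_all only: monoid_algebra_simps(4) monoid_algebra_distrib_left monoid_algebra_distrib_right)

end

lemma monoid_free_monoid: "monoid (free_monoid V)"
  by (rule monoidI) (auto simp: free_monoid_def)

lemma free_monoid_simps: "carrier (free_monoid V) = lists V" "s \<otimes>\<^bsub>free_monoid V\<^esub> t = s @ t"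
  "\<one>\<^bsub>free_monoid V\<^esub> = []"
  by (simp_all add: free_monoid_def)


lemma monoid_algebra_uminus:
  assumes "monoid M" "r \<in> carrier (monoid_algebra M)"
  shows "\<ominus>\<^bsub>monoid_algebra M\<^esub> r = - r"
  by (rule abelian_group.minus_equality[OF ring.is_abelian_group[OF ring_monoid_algebra[OF assms(1)]]])
    (use assms(2) in \<open>auto simp: monoid_algebra_simps in_keys_iff\<close>)

text \<open>
  The quotient algebras of interest are the quantum matrices and the bosonization; both are
  presented, so \<open>M\<close> is a free monoid in either case.
\<close>

locale monoid_algebra_quotient =
  fixes M :: "('m, 'z) monoid_scheme" and R :: "('m \<Rightarrow>\<^sub>0 'k::field) set"
  assumes M: "monoid M" and R: "R \<subseteq> carrier (monoid_algebra M)"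
begin

abbreviation "F \<equiv> monoid_algebra M :: ('k, 'm \<Rightarrow>\<^sub>0 'k) module"
abbreviation "Q \<equiv> quot_algebra F R"
abbreviation "\<pi> \<equiv> quot_proj F R"

lemma ring_F: "ring F"
  using ring_monoid_algebra[OF M] .

lemma ideal_R: "ideal (Idl\<^bsub>F\<^esub> R) F"
  using ring.genideal_ideal[OF ring_F R] .

lemma carrier_Q: "carrier Q = \<pi> ` carrier F"
  by (auto simp: quot_algebra_def ring.defs module.defs FactRing_simps quot_proj_def)

lemma proj_closed: "p \<in> carrier F \<Longrightarrow> \<pi> p \<in> carrier Q"
  by (simp add: carrier_Q)

lemma proj_mult:
  "p \<in> carrier F \<Longrightarrow> r \<in> carrier F \<Longrightarrow> \<pi> p \<otimes>\<^bsub>Q\<^esub> \<pi> r = \<pi> (p \<otimes>\<^bsub>F\<^esub> r)"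
  using ring_hom_mult[OF ideal.rcos_ring_hom[OF ideal_R]]
  by (simp add: quot_algebra_def ring.defs module.defs quot_proj_def)

lemma proj_add:
  "p \<in> carrier F \<Longrightarrow> r \<in> carrier F \<Longrightarrow> \<pi> p \<oplus>\<^bsub>Q\<^esub> \<pi> r = \<pi> (p + r)"
  using ring_hom_add[OF ideal.rcos_ring_hom[OF ideal_R]]
  by (simp add: quot_algebra_def ring.defs module.defs quot_proj_def monoid_algebra_simps)

lemma proj_one: "\<one>\<^bsub>Q\<^esub> = \<pi> (Poly_Mapping.single \<one>\<^bsub>M\<^esub> 1)"
  using ring_hom_one[OF ideal.rcos_ring_hom[OF ideal_R]]
  by (simp add: quot_algebra_def ring.defs module.defs quot_proj_def monoid_algebra_simps)

lemma scale_closed: "p \<in> carrier F \<Longrightarrow> Poly_Mapping.map ((*) c) p \<in> carrier F"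
  by (auto simp: monoid_algebra_simps in_keys_iff lookup_scale)

lemma single_closed: "s \<in> carrier M \<Longrightarrow> Poly_Mapping.single s c \<in> carrier F"
  by (simp add: monoid_algebra_simps)

text \<open>
  Scaling is multiplication by an element of the algebra, so every ideal is closed under it.
\<close>

lemma scale_eq_mult:
  assumes p: "p \<in> carrier F"
  shows "Poly_Mapping.map ((*) c) p = Poly_Mapping.single \<one>\<^bsub>M\<^esub> c \<otimes>\<^bsub>F\<^esub> p"
proof -
  have "Poly_Mapping.keys p \<subseteq> carrier M" using p by (simp add: monoid_algebra_simps)
  then show ?thesis
    by (induction p rule: poly_mapping_keys_induct)
      (simp_all add: map_scale_zero monoid_algebra_mult_zero monoid_algebra_distrib_left map_scale_add
        monoid_algebra_mult_single monoid.l_one[OF M])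
qed

lemma proj_eq_iff:
  assumes "p \<in> carrier F" "r \<in> carrier F"
  shows "\<pi> p = \<pi> r \<longleftrightarrow> p - r \<in> Idl\<^bsub>F\<^esub> R"
proof -
  interpret F: ring F by (rule ring_F)
  interpret I: ideal "Idl\<^bsub>F\<^esub> R" F by (rule ideal_R)
  have "p \<ominus>\<^bsub>F\<^esub> r = p - r"
    by (simp add: a_minus_def monoid_algebra_uminus[OF M assms(2)] monoid_algebra_simps)
  then show ?thesis
    using F.quotient_eq_iff_same_a_r_cos[OF ideal_R assms] by (simp add: quot_proj_def)
qed

lemma zero_Q: "\<zero>\<^bsub>Q\<^esub> = \<pi> 0"
proof -
  interpret F: ring F by (rule ring_F)
  interpret I: ideal "Idl\<^bsub>F\<^esub> R" F by (rule ideal_R)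
  have "Idl\<^bsub>F\<^esub> R +>\<^bsub>F\<^esub> \<zero>\<^bsub>F\<^esub> = Idl\<^bsub>F\<^esub> R"
    by (rule F.a_rcos_zero[OF ideal_R]) (rule I.zero_closed)
  then show ?thesis
    by (simp add: quot_algebra_def ring.defs module.defs quot_proj_def FactRing_def monoid_algebra_simps)
qed

lemma proj_eq_zero_iff: "p \<in> carrier F \<Longrightarrow> \<pi> p = \<zero>\<^bsub>Q\<^esub> \<longleftrightarrow> p \<in> Idl\<^bsub>F\<^esub> R"
  using proj_eq_iff[of p 0] by (simp add: zero_Q monoid_algebra_simps)

lemma proj_self: "p \<in> carrier F \<Longrightarrow> p \<in> \<pi> p"
proof -
  assume p: "p \<in> carrier F"
  interpret F: ring F by (rule ring_F)
  interpret I: ideal "Idl\<^bsub>F\<^esub> R" F by (rule ideal_R)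
  show ?thesis using I.a_rcos_self[OF p] by (simp add: quot_proj_def)
qed

lemma proj_memD:
  assumes "p \<in> carrier F" "u \<in> \<pi> p"
  shows "u \<in> carrier F" "\<pi> u = \<pi> p"
proof -
  interpret F: ring F by (rule ring_F)
  interpret I: ideal "Idl\<^bsub>F\<^esub> R" F by (rule ideal_R)
  show "u \<in> carrier F" 
    using assms I.a_elemrcos_carrier by (simp add: quot_proj_def)
  show "\<pi> u = \<pi> p"
    using assms I.a_repr_independence' by (simp add: quot_proj_def)
qed

text \<open>
  The scalar multiple of a coset is a union over its representatives. All members of this union are
  the same coset, because the ideal is closed under scaling.
\<close>

lemma proj_scale:
  assumes p: "p \<in> carrier F"
  shows "c \<odot>\<^bsub>Q\<^esub> \<pi> p = \<pi> (Poly_Mapping.map ((*) c) p)"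
proof -
  have "\<pi> (Poly_Mapping.map ((*) c) u) = \<pi> (Poly_Mapping.map ((*) c) p)" if "u \<in> \<pi> p" for u
  proof -
    have e: "Poly_Mapping.single \<one>\<^bsub>M\<^esub> c \<in> carrier F"
      by (rule single_closed[OF monoid.one_closed[OF M]])
    note u = proj_memD[OF p that]
    show ?thesis
      unfolding scale_eq_mult[OF p] scale_eq_mult[OF u(1)] proj_mult[OF e p, symmetric]
        proj_mult[OF e u(1), symmetric] u(2) ..
  qed
  moreover have "c \<odot>\<^bsub>Q\<^esub> \<pi> p = (\<Union>u\<in>\<pi> p. \<pi> (Poly_Mapping.map ((*) c) u))"
    unfolding quot_algebra_def quot_proj_def by (simp add: ring.defs module.defs monoid_algebra_simps)
  ultimately show ?thesis using proj_self[OF p] by blast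
qed

lemma sum_closed: "(\<And>s. s \<in> S \<Longrightarrow> p s \<in> carrier F) \<Longrightarrow> (\<Sum>s\<in>S. p s) \<in> carrier F"
proof (induction S rule: infinite_finite_induct)
  case (insert s S)
  then show ?case using Poly_Mapping.keys_add[of "p s" "sum p S"] by (auto simp: monoid_algebra_simps)
qed (simp_all add: monoid_algebra_simps)

text \<open>
  A linear endomorphism of the quotient need not come from a linear map of representatives, but a
  choice of representatives for the images of a finite family extends additively.
\<close>

lemma linear_proj_sum:
  assumes f: "f \<in> lin_map Q Q" and "finite S"
    and p: "\<And>s. s \<in> S \<Longrightarrow> p s \<in> carrier F" and r: "\<And>s. s \<in> S \<Longrightarrow> r s \<in> carrier F"
    and fp: "\<And>s. s \<in> S \<Longrightarrow> f (\<pi> (p s)) = \<pi> (r s)"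
  shows "f (\<pi> (\<Sum>s\<in>S. p s)) = \<pi> (\<Sum>s\<in>S. r s)"
  using assms(2) p r fp
proof (induction S)
  case empty
  have 0: "0 \<in> carrier F" by (simp add: monoid_algebra_simps)
  have z: "0 \<odot>\<^bsub>Q\<^esub> \<pi> t = \<pi> 0" if "t \<in> carrier F" for t
    using proj_scale[OF that, of 0] by (simp add: poly_mapping_eqI lookup_scale
      arg_cong[where f = \<pi>, OF poly_mapping_eqI[of "Poly_Mapping.map ((*) 0) t" 0]])
  have "f (\<pi> 0) \<in> carrier Q" using f proj_closed[OF 0] by (auto simp: lin_map_def)
  then obtain t where t: "t \<in> carrier F" "f (\<pi> 0) = \<pi> t" by (auto simp: carrier_Q)
  have "f (0 \<odot>\<^bsub>Q\<^esub> \<pi> 0) = 0 \<odot>\<^bsub>Q\<^esub> f (\<pi> 0)" using f proj_closed[OF 0] by (auto simp: lin_map_def)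
  then show ?case using z[OF 0] z[OF t(1)] t(2) by simp
next
  case (insert s S)
  have "f (\<pi> (p s) \<oplus>\<^bsub>Q\<^esub> \<pi> (sum p S)) = f (\<pi> (p s)) \<oplus>\<^bsub>Q\<^esub> f (\<pi> (sum p S))"
    using f insert.prems sum_closed[of S p] proj_closed by (auto simp: lin_map_def)
  then show ?case using insert sum_closed[of S p] sum_closed[of S r] by (simp add: proj_add)
qed

end

text \<open>
  This makes the obvious representative of a tensor a member of it.
\<close>

lemma zero_in_genideal: "0 \<in> Idl\<^bsub>monoid_algebra M\<^esub> R" for R :: "('m \<Rightarrow>\<^sub>0 'k::field) set"
proof -
  have "0 \<in> I" if "ideal I (monoid_algebra M)" for I :: "('m \<Rightarrow>\<^sub>0 'k) set"
    using additive_subgroup.zero_closed[OF ideal.axioms(1)[OF that]] by (simp add: monoid_algebra_simps)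
  then show ?thesis by (simp add: genideal_def)
qed

lemma k_algebra_scalars:
  assumes "k_algebra (W :: ('k::field, 'a) module)" and [simp]: "x \<in> carrier W"
  shows "1 \<odot>\<^bsub>W\<^esub> x = x" "(a + b) \<odot>\<^bsub>W\<^esub> x = a \<odot>\<^bsub>W\<^esub> x \<oplus>\<^bsub>W\<^esub> b \<odot>\<^bsub>W\<^esub> x"
    "(a * b) \<odot>\<^bsub>W\<^esub> x = a \<odot>\<^bsub>W\<^esub> (b \<odot>\<^bsub>W\<^esub> x)" "a \<odot>\<^bsub>W\<^esub> \<zero>\<^bsub>W\<^esub> = \<zero>\<^bsub>W\<^esub>"
    "0 \<odot>\<^bsub>W\<^esub> x = \<zero>\<^bsub>W\<^esub>"
    "a \<odot>\<^bsub>W\<^esub> x \<in> carrier W"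
proof -
  interpret W: module "ring_of_type_algebra :: 'k ring" W using assms(1) by (simp add: k_algebra_def)
  show "1 \<odot>\<^bsub>W\<^esub> x = x" using W.smult_one[OF assms(2)] by (simp add: ring_of_type_algebra_def)
  show "(a + b) \<odot>\<^bsub>W\<^esub> x = a \<odot>\<^bsub>W\<^esub> x \<oplus>\<^bsub>W\<^esub> b \<odot>\<^bsub>W\<^esub> x"
    using W.smult_l_distr[OF _ _ assms(2), of a b] by (simp add: ring_of_type_algebra_def)
  show "(a * b) \<odot>\<^bsub>W\<^esub> x = a \<odot>\<^bsub>W\<^esub> (b \<odot>\<^bsub>W\<^esub> x)"
    using W.smult_assoc1[OF _ _ assms(2), of a b] by (simp add: ring_of_type_algebra_def)
  show "a \<odot>\<^bsub>W\<^esub> \<zero>\<^bsub>W\<^esub> = \<zero>\<^bsub>W\<^esub>" using W.smult_r_null[of a] by (simp add: ring_of_type_algebra_def)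
  show "0 \<odot>\<^bsub>W\<^esub> x = \<zero>\<^bsub>W\<^esub>" using W.smult_l_null[OF assms(2)] by (simp add: ring_of_type_algebra_def)
  show "a \<odot>\<^bsub>W\<^esub> x \<in> carrier W" using W.smult_closed[OF _ assms(2), of a] by (simp add: ring_of_type_algebra_def)
qed

section \<open>Elements of degree at most two in quantum matrices\<close>

abbreviation "LA \<equiv> (1, 1) :: 2 \<times> 2"
abbreviation "LB \<equiv> (1, 2) :: 2 \<times> 2"
abbreviation "LC \<equiv> (2, 1) :: 2 \<times> 2"
abbreviation "LD \<equiv> (2, 2) :: 2 \<times> 2"

lemma one_neq_two_index [simp]: "(1::2) \<noteq> 2" "(2::2) \<noteq> 1"
  by simp_all

lemma UNIV_letters: "(UNIV :: (2 \<times> 2) set) = {LA, LB, LC, LD}"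
proof -
  have "v \<in> {LA, LB, LC, LD}" for v :: "2 \<times> 2"
    using exhaust_2[of "fst v"] exhaust_2[of "snd v"] by (cases v) auto
  then show ?thesis by blast
qed

lemma sum_letters: "(\<Sum>v\<in>UNIV. f v) = f LA + f LB + f LC + f LD"
  for f :: "2 \<times> 2 \<Rightarrow> 'a::comm_monoid_add"
  by (simp add: UNIV_letters add.assoc)

definition lin_poly :: "(2 \<times> 2 \<Rightarrow> 'k::field) \<Rightarrow> (2 \<times> 2) list \<Rightarrow>\<^sub>0 'k" where
  "lin_poly c = (\<Sum>v\<in>UNIV. Poly_Mapping.single [v] (c v))"

definition quad_poly :: "(2 \<times> 2 \<Rightarrow> 2 \<times> 2 \<Rightarrow> 'k::field) \<Rightarrow> (2 \<times> 2) list \<Rightarrow>\<^sub>0 'k" where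
  "quad_poly c = (\<Sum>u\<in>UNIV. \<Sum>v\<in>UNIV. Poly_Mapping.single [u, v] (c u v))"

lemma lookup_lin_poly: "Poly_Mapping.lookup (lin_poly c) [v] = c v"
  by (simp add: lin_poly_def lookup_sum lookup_single when_def)

lemma lookup_quad_poly: "Poly_Mapping.lookup (quad_poly c) [u, v] = c u v"
proof -
  have "Poly_Mapping.lookup (quad_poly c) [u, v] = 
     (\<Sum>u'\<in>UNIV. \<Sum>v'\<in>UNIV. if u' = u then (if v' = v then c u v else 0) else 0)"
    unfolding quad_poly_def lookup_sum by (intro sum.cong refl) (auto simp: lookup_single when_def)
  also have "\<dots> = (\<Sum>u'\<in>UNIV. if u' = u then c u v else 0)"
    by (intro sum.cong refl) simp
  finally show ?thesis by simp
qed

lemma carrier_free_algebra_UNIV [simp]: "carrier (free_algebra UNIV) = UNIV"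
  by (simp add: monoid_algebra_simps free_monoid_simps)

lemma lin_poly_mult:
  "lin_poly c \<otimes>\<^bsub>free_algebra UNIV\<^esub> lin_poly d = quad_poly (\<lambda>u v. c u * d v)"
  by (simp add: lin_poly_def quad_poly_def sum_letters monoid_algebra_distrib_left
    monoid_algebra_distrib_right monoid_algebra_mult_single free_monoid_simps add_ac)

text \<open>
  Words of length at most two have at most three factorizations, so these coefficients of a product
  are explicit.
\<close>

lemma lookup_mult_short:
  fixes p r :: "'x list \<Rightarrow>\<^sub>0 'k::field"
  defines "m \<equiv> p \<otimes>\<^bsub>free_algebra UNIV\<^esub> r"
  shows "Poly_Mapping.lookup m [] = Poly_Mapping.lookup p [] * Poly_Mapping.lookup r []"
    "Poly_Mapping.lookup m [u] = Poly_Mapping.lookup p [] * Poly_Mapping.lookup r [u]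
       + Poly_Mapping.lookup p [u] * Poly_Mapping.lookup r []"
    "Poly_Mapping.lookup m [u, v] = Poly_Mapping.lookup p [] * Poly_Mapping.lookup r [u, v]
       + Poly_Mapping.lookup p [u] * Poly_Mapping.lookup r [v]
       + Poly_Mapping.lookup p [u, v] * Poly_Mapping.lookup r []"
proof -
  let ?P = "\<lambda>p r. (let m = p \<otimes>\<^bsub>free_algebra UNIV\<^esub> r in
    Poly_Mapping.lookup m [] = Poly_Mapping.lookup p [] * Poly_Mapping.lookup r [] \<and>
    Poly_Mapping.lookup m [u] = Poly_Mapping.lookup p [] * Poly_Mapping.lookup r [u]
       + Poly_Mapping.lookup p [u] * Poly_Mapping.lookup r [] \<and>
    Poly_Mapping.lookup m [u, v] = Poly_Mapping.lookup p [] * Poly_Mapping.lookup r [u, v]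
       + Poly_Mapping.lookup p [u] * Poly_Mapping.lookup r [v]
       + Poly_Mapping.lookup p [u, v] * Poly_Mapping.lookup r [])"
  have single: "?P (Poly_Mapping.single s c) (Poly_Mapping.single t d)" for s t c d
    by (auto simp: Let_def monoid_algebra_mult_single free_monoid_simps lookup_single when_def
        append_eq_Cons_conv)
  have "?P (Poly_Mapping.single s c) r" for s c
    using subset_UNIV
  proof (induction r rule: poly_mapping_keys_induct)
    case (add t d r)
    then show ?case using single[of s c t d]
      by (simp add: Let_def monoid_algebra_distrib_left lookup_add algebra_simps)
  qed (simp add: monoid_algebra_mult_zero)
  note single_left = this
  have "?P p r"
    using subset_UNIV
  proof (induction p rule: poly_mapping_keys_induct)
    case (add t d p)
    then show ?case using single_left[of t d]
      by (simp add: Let_def monoid_algebra_distrib_right lookup_add algebra_simps)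
  qed (simp add: monoid_algebra_mult_zero)
  then show "Poly_Mapping.lookup m [] = Poly_Mapping.lookup p [] * Poly_Mapping.lookup r []"
    "Poly_Mapping.lookup m [u] = Poly_Mapping.lookup p [] * Poly_Mapping.lookup r [u]
       + Poly_Mapping.lookup p [u] * Poly_Mapping.lookup r []"
    "Poly_Mapping.lookup m [u, v] = Poly_Mapping.lookup p [] * Poly_Mapping.lookup r [u, v]
       + Poly_Mapping.lookup p [u] * Poly_Mapping.lookup r [v]
       + Poly_Mapping.lookup p [u, v] * Poly_Mapping.lookup r []"
    by (simp_all add: m_def Let_def)
qed

text \<open>
  Rewriting \<open>AB, AC, BD, CD, CB, AD\<close> by the relations turns the quadratic element \<open>\<Sum> c u v Y\<^sub>u Y\<^sub>v\<close> into
  a combination of the ten ordered monomials \<open>AA, BB, CC, DD, BA, CA, DB, DC, DA, BC\<close>. The conditions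
  say that its ten coefficients vanish, in this order.
\<close>

definition oqm2_quad_zero :: "'k::field \<Rightarrow> (2 \<times> 2 \<Rightarrow> 2 \<times> 2 \<Rightarrow> 'k) \<Rightarrow> bool" where
  "oqm2_quad_zero q c \<longleftrightarrow>
     c LA LA = 0 \<and> c LB LB = 0 \<and> c LC LC = 0 \<and> c LD LD = 0 \<and>
     q * c LA LB + c LB LA = 0 \<and> q * c LA LC + c LC LA = 0 \<and>
     q * c LB LD + c LD LB = 0 \<and> q * c LC LD + c LD LC = 0 \<and>
     c LA LD + c LD LA = 0 \<and> c LB LC + c LC LB + (q - inverse q) * c LA LD = 0"

lemma oqm2_quad_zero_0: "oqm2_quad_zero q (\<lambda>u v. 0)"
  by (simp add: oqm2_quad_zero_def)

lemma oqm2_quad_zero_add: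
  assumes "oqm2_quad_zero q c" "oqm2_quad_zero q d"
  shows "oqm2_quad_zero q (\<lambda>u v. c u v + d u v)"
proof -
  have *: "k * (a + b) + (c + d) = (k * a + c) + (k * b + d)"
    "(a + b) + (c + d) = (a + c) + (b + d)"
    "(a + b) + (c + d) + k * (e + f) = (a + c + k * e) + (b + d + k * f)" for a b c d e f k :: 'a
    by (simp_all add: algebra_simps)
  have last: "(c LB LC + d LB LC) + (c LC LB + d LC LB) + (q - inverse q) * (c LA LD + d LA LD) = 0"
    using assms unfolding *(3) by (simp add: oqm2_quad_zero_def)
  show ?thesis
    using assms last unfolding oqm2_quad_zero_def by (simp add: *(1,2))
qed

lemma oqm2_quad_zero_scale:
  assumes "oqm2_quad_zero q c"
  shows "oqm2_quad_zero q (\<lambda>u v. k * c u v)"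
proof -
  have *: "x + y = 0 \<Longrightarrow> k * x + k * y = 0" for x y :: 'a
    by (simp flip: distrib_left)
  have **: "x + y + z = 0 \<Longrightarrow> k * x + k * y + k * z = 0" for x y z :: 'a
    by (simp flip: distrib_left)
  show ?thesis
    using assms unfolding oqm2_quad_zero_def mult.left_commute[of _ k]
    by (auto intro!: * **)
qed

interpretation oqm2: monoid_algebra_quotient "free_monoid UNIV" "oqm2_rels q" for q :: "'k::field"
  by (rule monoid_algebra_quotient.intro) (simp_all add: monoid_free_monoid)

lemma oqm2_quot: "oqm2 q = quot_algebra (free_algebra UNIV) (oqm2_rels q)"
  by (simp add: oqm2_def presented_algebra_def)

abbreviation "oqm2_proj q \<equiv> quot_proj (free_algebra UNIV) (oqm2_rels q)"

text \<open>
  The elements with these three properties form an ideal: as their terms have degree at least two, a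
  factor changes their part of degree two only by its constant term. This ideal contains the relations.
  It replaces a full basis theorem, of which only the degrees one and two matter here.
\<close>

lemma oqm2_ideal_low_degree:
  fixes p :: "(2 \<times> 2) list \<Rightarrow>\<^sub>0 'k::field"
  assumes "p \<in> Idl\<^bsub>free_algebra UNIV\<^esub> (oqm2_rels q)"
  shows "Poly_Mapping.lookup p [] = 0" "Poly_Mapping.lookup p [v] = 0"
    "oqm2_quad_zero q (\<lambda>u v. Poly_Mapping.lookup p [u, v])"
proof -
  let ?J = "{p. Poly_Mapping.lookup p [] = 0 \<and> (\<forall>v. Poly_Mapping.lookup p [v] = 0) \<and>
    oqm2_quad_zero q (\<lambda>u v. Poly_Mapping.lookup p [u, v])}"
  have add: "p + r \<in> ?J" if "p \<in> ?J" "r \<in> ?J" for p r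
    using that oqm2_quad_zero_add by (auto simp: lookup_add)
  have mult: "r \<otimes>\<^bsub>free_algebra UNIV\<^esub> p \<in> ?J" "p \<otimes>\<^bsub>free_algebra UNIV\<^esub> r \<in> ?J" if "p \<in> ?J" for p r
    using that oqm2_quad_zero_scale[of q _ "Poly_Mapping.lookup r []"]
    by (auto simp: lookup_mult_short mult.commute[of _ "Poly_Mapping.lookup r []"]
        simp del: split_paired_All)
  have "ideal ?J (free_algebra UNIV)"
  proof (rule idealI)
    show "ring (free_algebra UNIV :: ('k, (2 \<times> 2) list \<Rightarrow>\<^sub>0 'k) module)"
      by (rule oqm2.ring_F)
    show "subgroup ?J (add_monoid (free_algebra UNIV))"
    proof (rule subgroup.intro)
      fix p assume p: "p \<in> ?J"
      have "inv\<^bsub>add_monoid (free_algebra UNIV)\<^esub> p = - p"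
        using monoid_algebra_uminus[OF monoid_free_monoid[of UNIV], of p] by (simp add: a_inv_def)
      also have "- p = Poly_Mapping.single [] (- 1) \<otimes>\<^bsub>free_algebra UNIV\<^esub> p"
        unfolding free_monoid_simps(3)[symmetric, of UNIV]
        by (subst oqm2.scale_eq_mult[symmetric])
          (simp_all add: lookup_scale poly_mapping_eqI)
      also have "\<dots> \<in> ?J" by (rule mult(1)[OF p])
      finally show "inv\<^bsub>add_monoid (free_algebra UNIV)\<^esub> p \<in> ?J" .
      fix r assume "r \<in> ?J"
      from add[OF p this] show "p \<otimes>\<^bsub>add_monoid (free_algebra UNIV)\<^esub> r \<in> ?J"
        by (simp add: monoid_algebra_simps)
    qed (simp_all add: monoid_algebra_simps(3) oqm2_quad_zero_0)
  qed (use mult in blast)+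
  moreover have "oqm2_rels q \<subseteq> ?J"
    by (auto simp: oqm2_rels_def Let_def oqm2_quad_zero_def lookup_add lookup_minus lookup_single when_def)
  ultimately have "p \<in> ?J"
    using ring.genideal_minimal[OF oqm2.ring_F] assms by blast
  then show "Poly_Mapping.lookup p [] = 0" "Poly_Mapping.lookup p [v] = 0"
    "oqm2_quad_zero q (\<lambda>u v. Poly_Mapping.lookup p [u, v])"
    by (auto simp del: split_paired_All)
qed

text \<open>
  One direction is the previous lemma; for the other, the ten conditions express \<open>c\<close> through six of
  its coefficients, which are, up to sign, the coefficients of the six relations.
\<close>

lemma oqm2_proj_quad_eq_zero_iff:
  fixes q :: "'k::field"
  shows
  "oqm2_proj q (quad_poly c) = \<zero>\<^bsub>oqm2 q\<^esub> \<longleftrightarrow> oqm2_quad_zero q c"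
proof
  assume "oqm2_proj q (quad_poly c) = \<zero>\<^bsub>oqm2 q\<^esub>"
  then have "quad_poly c \<in> Idl\<^bsub>free_algebra UNIV\<^esub> (oqm2_rels q)"
    by (simp add: oqm2_quot oqm2.proj_eq_zero_iff)
  from oqm2_ideal_low_degree(3)[OF this] show "oqm2_quad_zero q c"
    by (simp add: lookup_quad_poly)
next
  assume c: "oqm2_quad_zero q c"
  interpret I: ideal "Idl\<^bsub>free_algebra UNIV\<^esub> (oqm2_rels q)" "free_algebra UNIV" 
    by (rule oqm2.ideal_R)
  let ?w = "\<lambda>s t. Poly_Mapping.single [s, t] :: 'k \<Rightarrow> _"
  let ?m = "\<lambda>k p. Poly_Mapping.single [] k \<otimes>\<^bsub>free_algebra UNIV\<^esub> p"
  have eq: "quad_poly c = 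
     ?m (c LA LB) (?w LA LB 1 - ?w LB LA q) + ?m (c LA LC) (?w LA LC 1 - ?w LC LA q)
     + ?m (c LB LD) (?w LB LD 1 - ?w LD LB q) + ?m (c LC LD) (?w LC LD 1 - ?w LD LC q)
     + ?m (- c LC LB) (?w LB LC 1 - ?w LC LB 1)
     + ?m (c LA LD) (?w LA LD 1 - (?w LD LA 1 + ?w LB LC (q - inverse q)))"
  proof -
    have c': "c LB LA = - (c LA LB * q)" "c LC LA = - (c LA LC * q)" "c LD LB = - (c LB LD * q)"
      "c LD LC = - (c LC LD * q)" "c LD LA = - c LA LD"
      "c LB LC = - (c LA LD * (q - inverse q)) - c LC LB"
      using c unfolding oqm2_quad_zero_def by (simp_all add: algebra_simps eq_neg_iff_add_eq_0)
    have scaled: "?m k (x - y) = ?m k x - ?m k y" for k x y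
      using monoid_algebra_distrib_left[of "free_monoid UNIV" "Poly_Mapping.single [] k" "x - y" y] by simp
    have zero: "c LA LA = 0" "c LB LB = 0" "c LC LC = 0" "c LD LD = 0" 
      using c by (simp_all add: oqm2_quad_zero_def)
    show ?thesis
      unfolding quad_poly_def sum_letters scaled monoid_algebra_distrib_left monoid_algebra_mult_single
        free_monoid_simps zero c'
      by (simp add: single_uminus single_diff)
  qed
  have mem: "?m k r \<in> Idl\<^bsub>free_algebra UNIV\<^esub> (oqm2_rels q)" if "r \<in> oqm2_rels q" for k r
    using ring.genideal_self[OF oqm2.ring_F, of "oqm2_rels q"] that by (intro I.I_l_closed) auto
  note add = additive_subgroup.a_closed[OF ideal.axioms(1)[OF oqm2.ideal_R], unfolded monoid_algebra_simps]
  have "quad_poly c \<in> Idl\<^bsub>free_algebra UNIV\<^esub> (oqm2_rels q)"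
    unfolding eq by (intro add mem) (simp_all only: oqm2_rels_def Let_def insert_iff simp_thms)
  then show "oqm2_proj q (quad_poly c) = \<zero>\<^bsub>oqm2 q\<^esub>"
    by (simp add: oqm2_quot oqm2.proj_eq_zero_iff)
qed

lemma oqm2_proj_lin_inj: "oqm2_proj q (lin_poly c) = oqm2_proj q (lin_poly d) \<longleftrightarrow> c = d"
proof
  assume "oqm2_proj q (lin_poly c) = oqm2_proj q (lin_poly d)"
  then have "lin_poly c - lin_poly d \<in> Idl\<^bsub>free_algebra UNIV\<^esub> (oqm2_rels q)"
    by (simp add: oqm2.proj_eq_iff)
  from oqm2_ideal_low_degree(2)[OF this] have "c v = d v" for v
    by (simp add: lookup_minus lookup_lin_poly)
  then show "c = d" ..
qed simp

definition oqm2_lin :: "'k::field \<Rightarrow> (2 \<times> 2 \<Rightarrow> 'k) \<Rightarrow> ((2 \<times> 2) list \<Rightarrow>\<^sub>0 'k) set" where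
  "oqm2_lin q c = oqm2_proj q (lin_poly c)"

definition oqm2_quad :: "'k::field \<Rightarrow> (2 \<times> 2 \<Rightarrow> 2 \<times> 2 \<Rightarrow> 'k) \<Rightarrow> ((2 \<times> 2) list \<Rightarrow>\<^sub>0 'k) set" where
  "oqm2_quad q c = oqm2_proj q (quad_poly c)"

abbreviation delta :: "2 \<times> 2 \<Rightarrow> 2 \<times> 2 \<Rightarrow> 'k::field" where
  "delta v \<equiv> (\<lambda>k. of_bool (k = v))"

lemma lin_poly_delta: "lin_poly (\<lambda>k. a * of_bool (k = v)) = Poly_Mapping.single [v] a"
proof -
  have "lin_poly (\<lambda>k. a * of_bool (k = v)) = (\<Sum>u\<in>UNIV. if u = v then Poly_Mapping.single [v] a else 0)"
    unfolding lin_poly_def by (intro sum.cong refl) auto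
  then show ?thesis by simp
qed

lemma oqm2_Y_eq: "oqm2_Y q i j = oqm2_lin q (delta (i, j))" for q :: "'k::field"
  using lin_poly_delta[of "1::'k" "(i, j)"] by (simp add: oqm2_Y_def oqm2_lin_def presented_gen_def)

lemma carrier_oqm2: "carrier (oqm2 q) = range (oqm2_proj q)"
  by (simp add: oqm2_quot oqm2.carrier_Q)

lemma oqm2_lin_closed [simp]: "oqm2_lin q c \<in> carrier (oqm2 q)"
  by (simp add: carrier_oqm2 oqm2_lin_def)

lemma lin_poly_add: "lin_poly c + lin_poly d = lin_poly (\<lambda>v. c v + d v)"
  by (simp add: lin_poly_def single_add sum.distrib)

lemma quad_poly_add: "quad_poly c + quad_poly d = quad_poly (\<lambda>u v. c u v + d u v)"
  by (simp add: quad_poly_def single_add sum.distrib)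

lemma oqm2_lin_add: "oqm2_lin q c \<oplus>\<^bsub>oqm2 q\<^esub> oqm2_lin q d = oqm2_lin q (\<lambda>v. c v + d v)"
  by (simp add: oqm2_quot oqm2_lin_def oqm2.proj_add lin_poly_add)

lemma oqm2_lin_scale: "a \<odot>\<^bsub>oqm2 q\<^esub> oqm2_lin q c = oqm2_lin q (\<lambda>v. a * c v)"
  by (simp add: oqm2_quot oqm2_lin_def oqm2.proj_scale lin_poly_def map_scale_sum map_scale_single)

lemma oqm2_quad_add: "oqm2_quad q c \<oplus>\<^bsub>oqm2 q\<^esub> oqm2_quad q d = oqm2_quad q (\<lambda>u v. c u v + d u v)"
  by (simp add: oqm2_quot oqm2_quad_def oqm2.proj_add quad_poly_add)

lemma oqm2_lin_mult: "oqm2_lin q c \<otimes>\<^bsub>oqm2 q\<^esub> oqm2_lin q d = oqm2_quad q (\<lambda>u v. c u * d v)"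
  by (simp add: oqm2_quot oqm2_lin_def oqm2_quad_def oqm2.proj_mult lin_poly_mult)

lemma oqm2_lin_inj: "oqm2_lin q c = oqm2_lin q d \<longleftrightarrow> c = d"
  by (simp add: oqm2_lin_def oqm2_proj_lin_inj)

lemma oqm2_quad_eq_0_iff: "oqm2_quad q c = \<zero>\<^bsub>oqm2 q\<^esub> \<longleftrightarrow> oqm2_quad_zero q c"
  by (simp add: oqm2_quad_def oqm2_proj_quad_eq_zero_iff)

lemma linear_oqm2_lin:
  assumes f: "f \<in> lin_map (oqm2 q) (oqm2 q)" and U: "\<And>v. f (oqm2_lin q (delta v)) = oqm2_lin q (\<lambda>k. U k v)"
  shows "f (oqm2_lin q c) = oqm2_lin q (\<lambda>k. \<Sum>v\<in>UNIV. U k v * c v)"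
proof -
  have "f (oqm2_proj q (\<Sum>v\<in>UNIV. lin_poly (\<lambda>k. c v * delta v k))) =
      oqm2_proj q (\<Sum>v\<in>UNIV. lin_poly (\<lambda>k. c v * U k v))"
  proof (rule oqm2.linear_proj_sum)
    show "f \<in> lin_map (quot_algebra (free_algebra UNIV) (oqm2_rels q)) (quot_algebra (free_algebra UNIV) (oqm2_rels q))"
      using f by (simp add: oqm2_quot)
    fix v
    have "f (c v \<odot>\<^bsub>oqm2 q\<^esub> oqm2_lin q (delta v)) = c v \<odot>\<^bsub>oqm2 q\<^esub> f (oqm2_lin q (delta v))"
      using f by (simp add: lin_map_def)
    then show "f (oqm2_proj q (lin_poly (\<lambda>k. c v * delta v k))) = oqm2_proj q (lin_poly (\<lambda>k. c v * U k v))"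
      unfolding U oqm2_lin_scale by (simp add: oqm2_lin_def)
  qed simp_all
  moreover have "(\<Sum>v\<in>UNIV. lin_poly (\<lambda>k. c v * delta v k)) = lin_poly c"
    unfolding lin_poly_delta by (simp add: lin_poly_def)
  moreover have "(\<Sum>v\<in>UNIV. lin_poly (\<lambda>k. c v * U k v)) = lin_poly (\<lambda>k. \<Sum>v\<in>UNIV. U k v * c v)"
    by (simp add: sum_letters lin_poly_add mult.commute)
  ultimately show ?thesis by (simp add: oqm2_lin_def)
qed

lemma linear_oqm2_quad:
  assumes f: "f \<in> lin_map (oqm2 q) (oqm2 q)"
    and N: "\<And>u v. f (oqm2_lin q (delta u) \<otimes>\<^bsub>oqm2 q\<^esub> oqm2_lin q (delta v)) = oqm2_quad q (N u v)"
  shows "f (oqm2_quad q c) = oqm2_quad q (\<lambda>k l. \<Sum>u\<in>UNIV. \<Sum>v\<in>UNIV. c u v * N u v k l)"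
proof -
  have scale: "a \<odot>\<^bsub>oqm2 q\<^esub> oqm2_quad q d = oqm2_quad q (\<lambda>u v. a * d u v)" for a d
    by (simp add: oqm2_quot oqm2_quad_def oqm2.proj_scale quad_poly_def map_scale_sum map_scale_single)
  have "f (oqm2_proj q (\<Sum>u\<in>UNIV. \<Sum>v\<in>UNIV. quad_poly (\<lambda>k l. c u v * (delta u k * delta v l)))) =
      oqm2_proj q (\<Sum>u\<in>UNIV. \<Sum>v\<in>UNIV. quad_poly (\<lambda>k l. c u v * N u v k l))"
  proof (intro oqm2.linear_proj_sum)
    show "f \<in> lin_map (quot_algebra (free_algebra UNIV) (oqm2_rels q)) (quot_algebra (free_algebra UNIV) (oqm2_rels q))"
      using f by (simp add: oqm2_quot)
    then show "f \<in> lin_map (quot_algebra (free_algebra UNIV) (oqm2_rels q)) (quot_algebra (free_algebra UNIV) (oqm2_rels q))" .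
    fix u v
    have "f (c u v \<odot>\<^bsub>oqm2 q\<^esub> oqm2_quad q (\<lambda>k l. delta u k * delta v l)) = c u v \<odot>\<^bsub>oqm2 q\<^esub> f (oqm2_quad q (\<lambda>k l. delta u k * delta v l))"
      using f by (simp add: lin_map_def oqm2_quad_def carrier_oqm2)
    then show "f (oqm2_proj q (quad_poly (\<lambda>k l. c u v * (delta u k * delta v l)))) = oqm2_proj q (quad_poly (\<lambda>k l. c u v * N u v k l))"
      unfolding oqm2_lin_mult[symmetric] N unfolding oqm2_lin_mult scale by (simp add: oqm2_quad_def)
  qed simp_all
  moreover have "(\<Sum>u\<in>UNIV. \<Sum>v\<in>UNIV. quad_poly (\<lambda>k l. c u v * (delta u k * delta v l))) = quad_poly c"
    by (simp add: sum_letters quad_poly_add) (simp add: quad_poly_def sum_letters)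
  moreover have "(\<Sum>u\<in>UNIV. \<Sum>v\<in>UNIV. quad_poly (\<lambda>k l. c u v * N u v k l)) = 
    quad_poly (\<lambda>k l. \<Sum>u\<in>UNIV. \<Sum>v\<in>UNIV. c u v * N u v k l)"
    by (simp add: sum_letters quad_poly_add)
  ultimately show ?thesis by (simp add: oqm2_quad_def)
qed

text \<open>
  All equations between matrix entries come from this: if the values of a linear map on products of two
  generators are known, then its values on combinations that vanish must vanish.
\<close>

lemma linear_oqm2_quad_zero:
  assumes f: "f \<in> lin_map (oqm2 q) (oqm2 q)"
    and N: "\<And>u v. f (oqm2_lin q (delta u) \<otimes>\<^bsub>oqm2 q\<^esub> oqm2_lin q (delta v)) = oqm2_quad q (N u v)"
    and c: "oqm2_quad_zero q c"
  shows "oqm2_quad_zero q (\<lambda>k l. \<Sum>u\<in>UNIV. \<Sum>v\<in>UNIV. c u v * N u v k l)"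
proof -
  have z: "oqm2_quad q c' = \<zero>\<^bsub>oqm2 q\<^esub>" if "oqm2_quad_zero q c'" for c'
    using that by (simp only: oqm2_quad_eq_0_iff)
  have "oqm2_quad q (\<lambda>k l. \<Sum>u\<in>UNIV. \<Sum>v\<in>UNIV. c u v * N u v k l) = f (oqm2_quad q c)"
    by (rule linear_oqm2_quad[OF f N, symmetric])
  also have "\<dots> = f (oqm2_quad q (\<lambda>u v. 0))"
    by (simp only: z[OF c] z[OF oqm2_quad_zero_0])
  also have "\<dots> = oqm2_quad q (\<lambda>k l. \<Sum>u\<in>UNIV. \<Sum>v\<in>UNIV. 0 * N u v k l)"
    by (rule linear_oqm2_quad[OF f N])
  also have "\<dots> = \<zero>\<^bsub>oqm2 q\<^esub>"
    by (simp only: mult_zero_left sum.neutral_const z[OF oqm2_quad_zero_0])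
  finally show ?thesis by (simp only: oqm2_quad_eq_0_iff)
qed

text \<open>
  As the generators are linearly independent, relations between operators can be read off their
  matrices.
\<close>

lemma linear_maps_commutation:
  assumes f: "f \<in> lin_map (oqm2 q) (oqm2 q)" and h: "h \<in> lin_map (oqm2 q) (oqm2 q)"
    and U: "\<And>v. f (oqm2_lin q (delta v)) = oqm2_lin q (\<lambda>k. U k v)"
    and V: "\<And>v. h (oqm2_lin q (delta v)) = oqm2_lin q (\<lambda>k. V k v)"
    and comm: "\<And>a. a \<in> carrier (oqm2 q) \<Longrightarrow> f (h a) = c \<odot>\<^bsub>oqm2 q\<^esub> h (f a)"
  shows "(\<Sum>m\<in>UNIV. U k m * V m l) = c * (\<Sum>m\<in>UNIV. V k m * U m l)"
proof -
  have "f (h (oqm2_lin q (delta l))) = c \<odot>\<^bsub>oqm2 q\<^esub> h (f (oqm2_lin q (delta l)))"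
    by (rule comm) simp
  then have "(\<lambda>k. \<Sum>m\<in>UNIV. U k m * V m l) = (\<lambda>k. c * (\<Sum>m\<in>UNIV. V k m * U m l))"
    unfolding U V linear_oqm2_lin[OF f U] linear_oqm2_lin[OF h V] oqm2_lin_scale oqm2_lin_inj .
  then show ?thesis by (rule fun_cong)
qed

text \<open>
  By induction on the length of a word, a skew derivation is determined by its values on \<open>1\<close> and on the
  generators.
\<close>

lemma skew_map_eq_0:
  fixes q :: "'k::field"
  assumes f: "f \<in> lin_map (oqm2 q) (oqm2 q)" and h: "h \<in> lin_map (oqm2 q) (oqm2 q)"
    and skew: "\<And>a b. a \<in> carrier (oqm2 q) \<Longrightarrow> b \<in> carrier (oqm2 q) \<Longrightarrow>
      f (a \<otimes>\<^bsub>oqm2 q\<^esub> b) = (h a \<otimes>\<^bsub>oqm2 q\<^esub> f b) \<oplus>\<^bsub>oqm2 q\<^esub> (f a \<otimes>\<^bsub>oqm2 q\<^esub> b)"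
    and one: "f \<one>\<^bsub>oqm2 q\<^esub> = \<zero>\<^bsub>oqm2 q\<^esub>"
    and letters: "\<And>v. f (oqm2_lin q (delta v)) = \<zero>\<^bsub>oqm2 q\<^esub>"
    and R: "k_algebra (oqm2 q)" and a: "a \<in> carrier (oqm2 q)"
  shows "f a = \<zero>\<^bsub>oqm2 q\<^esub>"
proof -
  interpret R: ring "oqm2 q" using R by (simp add: k_algebra_def)
  have closed: "oqm2_proj q p \<in> carrier (oqm2 q)" for p by (simp add: carrier_oqm2)
  have h_closed: "h b \<in> carrier (oqm2 q)" if "b \<in> carrier (oqm2 q)" for b
    using h that by (auto simp: lin_map_def)
  have zero: "\<zero>\<^bsub>oqm2 q\<^esub> = oqm2_proj q 0" by (simp add: oqm2_quot oqm2.zero_Q)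
  have word: "f (oqm2_proj q (Poly_Mapping.single s c)) = \<zero>\<^bsub>oqm2 q\<^esub>" for s c
  proof (induction s)
    case Nil
    have "oqm2_proj q (Poly_Mapping.single [] c) = c \<odot>\<^bsub>oqm2 q\<^esub> \<one>\<^bsub>oqm2 q\<^esub>"
      by (simp add: oqm2_quot oqm2.proj_one oqm2.proj_scale map_scale_single free_monoid_simps)
    then have "f (oqm2_proj q (Poly_Mapping.single [] c)) = c \<odot>\<^bsub>oqm2 q\<^esub> f \<one>\<^bsub>oqm2 q\<^esub>"
      using f by (simp add: lin_map_def)
    then show ?case by (simp add: one k_algebra_scalars(4)[OF R R.zero_closed])
  next
    case (Cons v s)
    have "oqm2_lin q (delta v) = oqm2_proj q (Poly_Mapping.single [v] 1)"
      using lin_poly_delta[of "1::'k" v] by (simp add: oqm2_lin_def)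
    then have "oqm2_proj q (Poly_Mapping.single (v # s) c) =
        oqm2_lin q (delta v) \<otimes>\<^bsub>oqm2 q\<^esub> oqm2_proj q (Poly_Mapping.single s c)"
      by (simp add: oqm2_quot oqm2.proj_mult monoid_algebra_mult_single free_monoid_simps)
    then show ?case
      using skew[OF oqm2_lin_closed closed] by (simp add: Cons letters h_closed closed)
  qed
  obtain p where p: "a = oqm2_proj q p" using a by (auto simp: carrier_oqm2)
  have "f (oqm2_proj q (\<Sum>s\<in>Poly_Mapping.keys p. Poly_Mapping.single s (Poly_Mapping.lookup p s))) =
      oqm2_proj q (\<Sum>s\<in>Poly_Mapping.keys p. 0)"
    by (rule oqm2.linear_proj_sum) (use f word zero in \<open>simp_all add: oqm2_quot\<close>)
  moreover have "(\<Sum>s\<in>Poly_Mapping.keys p. Poly_Mapping.single s (Poly_Mapping.lookup p s)) = p"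
    by (rule poly_mapping_eqI) (simp add: lookup_sum lookup_single when_def in_keys_iff)
  ultimately show ?thesis by (simp add: p zero)
qed

section \<open>The torus and the transposition on the generators\<close>

lemma oqm2_linear_span:
  fixes q :: "'k::field"
  assumes "k_algebra (oqm2 q)"
  shows "y \<in> oqm2_linear_span q \<Longrightarrow> \<exists>c. y = oqm2_lin q c"
    and "oqm2_lin q (delta v) \<in> oqm2_linear_span q"
proof -
  interpret R: ring "oqm2 q" using assms by (simp add: k_algebra_def)
  define Y where "Y = {oqm2_Y q i j |i j. True}"
  have Y_D: "\<exists>v. s = oqm2_lin q (delta v)" if s: "s \<in> Y" for s
  proof -
    obtain i j where "s = oqm2_Y q i j" using s unfolding Y_def by blast
    then have "s = oqm2_lin q (delta (i, j))" by (simp only: oqm2_Y_eq)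
    then show ?thesis by (rule exI)
  qed
  have Y_I: "oqm2_lin q (delta v) \<in> Y" for v
  proof -
    have "oqm2_lin q (delta v) = oqm2_Y q (fst v) (snd v)" by (simp only: oqm2_Y_eq prod.collapse)
    then show ?thesis unfolding Y_def by (intro CollectI exI conjI TrueI)
  qed
  have sub: "\<exists>d. finsum (oqm2 q) (\<lambda>s. c s \<odot>\<^bsub>oqm2 q\<^esub> s) T = oqm2_lin q d" if "finite T" "T \<subseteq> Y" for c T
    using that
  proof (induction T)
    case empty
    have "oqm2_lin q (\<lambda>v. 0) = \<zero>\<^bsub>oqm2 q\<^esub>"
      by (simp add: oqm2_lin_def lin_poly_def oqm2_quot oqm2.zero_Q)
    then have "finsum (oqm2 q) (\<lambda>s. c s \<odot>\<^bsub>oqm2 q\<^esub> s) {} = oqm2_lin q (\<lambda>v. 0)"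
      by (simp only: R.finsum_empty)
    then show ?case by blast
  next
    case (insert s T)
    have "T \<subseteq> Y" "s \<in> Y" using insert.prems by blast+
    obtain d where d: "finsum (oqm2 q) (\<lambda>s. c s \<odot>\<^bsub>oqm2 q\<^esub> s) T = oqm2_lin q d"
      using insert.IH[OF \<open>T \<subseteq> Y\<close>] by (elim exE)
    obtain v where v: "s = oqm2_lin q (delta v)" using Y_D[OF \<open>s \<in> Y\<close>] by (elim exE)
    have closed: "c t \<odot>\<^bsub>oqm2 q\<^esub> t \<in> carrier (oqm2 q)" if t: "t \<in> insert s T" for t
    proof -
      obtain v' where "t = oqm2_lin q (delta v')" using Y_D[OF subsetD[OF insert.prems t]] by (elim exE)
      then show ?thesis by (simp only: oqm2_lin_scale oqm2_lin_closed)
    qed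
    have "finsum (oqm2 q) (\<lambda>s. c s \<odot>\<^bsub>oqm2 q\<^esub> s) (insert s T) =
        c s \<odot>\<^bsub>oqm2 q\<^esub> s \<oplus>\<^bsub>oqm2 q\<^esub> finsum (oqm2 q) (\<lambda>s. c s \<odot>\<^bsub>oqm2 q\<^esub> s) T"
      using insert.hyps closed by (intro R.finsum_insert) auto
    also have "\<dots> = oqm2_lin q (\<lambda>u. c s * delta v u + d u)"
    proof -
      have "c s \<odot>\<^bsub>oqm2 q\<^esub> s = oqm2_lin q (\<lambda>u. c s * delta v u)"
        using oqm2_lin_scale[of q "c s" "delta v"] unfolding v[symmetric] .
      then show ?thesis by (simp only: d oqm2_lin_add)
    qed
    finally show ?case by blast
  qed
  show "\<exists>c. y = oqm2_lin q c" if y: "y \<in> oqm2_linear_span q"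
  proof -
    obtain c T where "y = finsum (oqm2 q) (\<lambda>s. c s \<odot>\<^bsub>oqm2 q\<^esub> s) T" "finite T" "T \<subseteq> Y"
      using y unfolding oqm2_linear_span_def lin_span_def Y_def[symmetric] by blast
    then show ?thesis using sub by blast
  qed
  have "finsum (oqm2 q) (\<lambda>s. 1 \<odot>\<^bsub>oqm2 q\<^esub> s) {oqm2_lin q (delta v)} = oqm2_lin q (delta v)"
    by (subst R.finsum_insert) (simp_all add: oqm2_lin_scale)
  then show "oqm2_lin q (delta v) \<in> oqm2_linear_span q"
    unfolding oqm2_linear_span_def lin_span_def Y_def[symmetric] using Y_I
    by (intro CollectI exI[of _ "\<lambda>_. 1"] exI[of _ "{oqm2_lin q (delta v)}"]) (rule conjI, erule sym, simp only: finite.intros insert_subset empty_subsetI simp_thms)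
qed

text \<open>
  A product of elements of \<open>{\<tau>, \<tau>\<inverse>}\<close> either fixes or transposes all generators, which is recorded by
  \<open>\<sigma>\<close>. The identity between the weights of a torus element holds because it respects
  \<open>AD - DA = (q - q\<inverse>) BC\<close>, whose two sides are scaled by \<open>w(A) w(D)\<close> and \<open>w(B) w(C)\<close>.
\<close>

lemma torus_transp_on_letters:
  fixes q :: "'a::field"
  assumes "\<phi> \<in> oqm2_torus_transp q" "q \<noteq> 0" "q^2 \<noteq> 1"
  obtains w \<sigma> where "\<sigma> = id \<or> \<sigma> = prod.swap" "\<And>v. w v \<noteq> 0" "w LA * w LD = w LB * w LC"
    "\<And>v. \<phi> (oqm2_lin q (delta v)) = oqm2_lin q (\<lambda>k. w k * of_bool (k = \<sigma> v))"
    "\<phi> \<one>\<^bsub>oqm2 q\<^esub> = \<one>\<^bsub>oqm2 q\<^esub>"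
proof -
  have one_closed: "\<one>\<^bsub>oqm2 q\<^esub> \<in> carrier (oqm2 q)"
    by (simp add: oqm2_quot oqm2.proj_one oqm2.proj_closed)
  let ?G = "BijGroup (carrier (oqm2 q))"
  obtain h t where h: "h \<in> oqm2_torus q" and t: "t \<in> generate ?G (oqm2_transp q)"
    and \<phi>: "\<phi> = h \<otimes>\<^bsub>?G\<^esub> t"
    using assms(1) by (auto simp: oqm2_torus_transp_def set_mult_def)
  have t': "t \<in> Bij (carrier (oqm2 q)) \<and> t \<one>\<^bsub>oqm2 q\<^esub> = \<one>\<^bsub>oqm2 q\<^esub> \<and> (\<exists>\<sigma>. (\<sigma> = id \<or> \<sigma> = prod.swap) \<and>
      (\<forall>v. t (oqm2_lin q (delta v)) = oqm2_lin q (delta (\<sigma> v))))"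
    using t
  proof induction
    case one
    have "\<one>\<^bsub>?G\<^esub> \<in> Bij (carrier (oqm2 q))"
      using group.is_monoid[OF group_BijGroup, THEN monoid.one_closed, of "carrier (oqm2 q)"]
      by (simp only: BijGroup_def partial_object.simps)
    moreover have "\<one>\<^bsub>?G\<^esub> a = a" if "a \<in> carrier (oqm2 q)" for a
      using that by (simp add: BijGroup_def)
    ultimately show ?case using one_closed by (intro conjI exI[of _ id]) simp_all
  next
    case (incl t)
    then show ?case by (auto simp: oqm2_transp_def alg_auto_def alg_hom_def oqm2_Y_eq ring_hom_one intro!: exI[of _ prod.swap])
  next
    case (inv t)
    then have t: "t \<in> Bij (carrier (oqm2 q))" and swap: "t (oqm2_lin q (delta (prod.swap v))) = oqm2_lin q (delta v)"
      and t1: "t \<one>\<^bsub>oqm2 q\<^esub> = \<one>\<^bsub>oqm2 q\<^esub>" for v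
      by (simp_all add: oqm2_transp_def alg_auto_def alg_hom_def oqm2_Y_eq ring_hom_one prod.swap_def)
    have inj: "inj_on t (carrier (oqm2 q))" using t by (simp add: Bij_def bij_betw_def)
    have "inv_into (carrier (oqm2 q)) t (oqm2_lin q (delta v)) = oqm2_lin q (delta (prod.swap v))" for v
      by (rule inv_into_f_eq[OF inj _ swap]) simp
    moreover have "inv_into (carrier (oqm2 q)) t \<one>\<^bsub>oqm2 q\<^esub> = \<one>\<^bsub>oqm2 q\<^esub>"
      by (rule inv_into_f_eq[OF inj one_closed t1])
    moreover have "inv\<^bsub>?G\<^esub> t \<in> Bij (carrier (oqm2 q))"
      unfolding inv_BijGroup[OF t] by (rule restrict_inv_into_Bij[OF t])
    moreover have "(inv\<^bsub>?G\<^esub> t) a = inv_into (carrier (oqm2 q)) t a" if "a \<in> carrier (oqm2 q)" for a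
      unfolding inv_BijGroup[OF t] using that by simp
    ultimately show ?case using one_closed by (intro conjI exI[of _ prod.swap]) simp_all
  next
    case (eng t1 t2)
    then obtain \<sigma>1 \<sigma>2 where t1: "t1 \<in> Bij (carrier (oqm2 q))" "t1 \<one>\<^bsub>oqm2 q\<^esub> = \<one>\<^bsub>oqm2 q\<^esub>" "\<sigma>1 = id \<or> \<sigma>1 = prod.swap"
        "\<And>v. t1 (oqm2_lin q (delta v)) = oqm2_lin q (delta (\<sigma>1 v))"
      and t2: "t2 \<in> Bij (carrier (oqm2 q))" "t2 \<one>\<^bsub>oqm2 q\<^esub> = \<one>\<^bsub>oqm2 q\<^esub>" "\<sigma>2 = id \<or> \<sigma>2 = prod.swap"
        "\<And>v. t2 (oqm2_lin q (delta v)) = oqm2_lin q (delta (\<sigma>2 v))"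
      by blast
    have eq: "t1 \<otimes>\<^bsub>?G\<^esub> t2 = compose (carrier (oqm2 q)) t1 t2"
      using t1(1) t2(1) by (simp add: BijGroup_def)
    have app: "(t1 \<otimes>\<^bsub>?G\<^esub> t2) a = t1 (t2 a)" if "a \<in> carrier (oqm2 q)" for a
      unfolding eq using that by (simp add: compose_def)
    show ?case
    proof (intro conjI exI[of _ "\<sigma>1 \<circ> \<sigma>2"] allI)
      show "t1 \<otimes>\<^bsub>?G\<^esub> t2 \<in> Bij (carrier (oqm2 q))"
        unfolding eq by (rule compose_Bij[OF t1(1) t2(1)])
      show "(t1 \<otimes>\<^bsub>?G\<^esub> t2) \<one>\<^bsub>oqm2 q\<^esub> = \<one>\<^bsub>oqm2 q\<^esub>"
        using app[OF one_closed] t1(2) t2(2) by simp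
      show "\<sigma>1 \<circ> \<sigma>2 = id \<or> \<sigma>1 \<circ> \<sigma>2 = prod.swap"
        using t1(3) t2(3) by auto
      show "(t1 \<otimes>\<^bsub>?G\<^esub> t2) (oqm2_lin q (delta v)) = oqm2_lin q (delta ((\<sigma>1 \<circ> \<sigma>2) v))" for v
        using app[OF oqm2_lin_closed] by (simp add: t1(4) t2(4))
    qed
  qed
  then obtain \<sigma> where \<sigma>: "t \<in> Bij (carrier (oqm2 q))" "\<sigma> = id \<or> \<sigma> = prod.swap"
      "\<And>v. t (oqm2_lin q (delta v)) = oqm2_lin q (delta (\<sigma> v))"
      and t1: "t \<one>\<^bsub>oqm2 q\<^esub> = \<one>\<^bsub>oqm2 q\<^esub>" by blast
  obtain \<alpha> :: "'a^2^2" where \<alpha>: "\<And>i j. vec_nth (vec_nth \<alpha> i) j \<noteq> 0"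
      "\<And>i j. h (oqm2_Y q i j) = vec_nth (vec_nth \<alpha> i) j \<odot>\<^bsub>oqm2 q\<^esub> oqm2_Y q i j"
    and hauto: "h \<in> alg_auto (oqm2 q)"
    using h by (auto simp: oqm2_torus_def)
  define w where "w v = vec_nth (vec_nth \<alpha> (fst v)) (snd v)" for v
  have hw: "h (oqm2_lin q (delta v)) = oqm2_lin q (\<lambda>k. w k * of_bool (k = v))" for v
  proof -
    have "h (oqm2_lin q (delta v)) = oqm2_lin q (\<lambda>k. w v * of_bool (k = v))"
      using \<alpha>(2)[of "fst v" "snd v"] by (simp add: oqm2_Y_eq oqm2_lin_scale w_def)
    also have "(\<lambda>k. w v * of_bool (k = v)) = (\<lambda>k. w k * of_bool (k = v))" by auto
    finally show ?thesis .
  qed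
  have hlin: "h \<in> lin_map (oqm2 q) (oqm2 q)" and hhom: "h \<in> ring_hom (oqm2 q) (oqm2 q)" and hbij: "h \<in> Bij (carrier (oqm2 q))"
    using hauto by (auto simp: alg_auto_def alg_hom_def)
  have "w LA * w LD = w LB * w LC"
  proof -
    (* The relation AD - DA - (q - 1/q) BC, to which h is applied. *)
    let ?c = "\<lambda>u v. of_bool (u = LA \<and> v = LD) - of_bool (u = LD \<and> v = LA) + (inverse q - q) * of_bool (u = LB \<and> v = LC)"
    have c: "oqm2_quad_zero q ?c" by (simp add: oqm2_quad_zero_def)
    have hh: "h (oqm2_lin q (delta u) \<otimes>\<^bsub>oqm2 q\<^esub> oqm2_lin q (delta v)) =
       oqm2_quad q (\<lambda>k l. w k * of_bool (k = u) * (w l * of_bool (l = v)))" for u v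
      using ring_hom_mult[OF hhom, of "oqm2_lin q (delta u)" "oqm2_lin q (delta v)"]
      unfolding hw oqm2_lin_mult by simp
    have "oqm2_quad_zero q (\<lambda>k l. \<Sum>u\<in>UNIV. \<Sum>v\<in>UNIV. ?c u v * (w k * of_bool (k = u) * (w l * of_bool (l = v))))"
      by (rule linear_oqm2_quad_zero[OF hlin hh c])
    then have "(inverse q - q) * (w LB * w LC) + (q - inverse q) * (w LA * w LD) = 0"
      by (simp add: oqm2_quad_zero_def sum_letters)
    then have "(q - inverse q) * (w LA * w LD - w LB * w LC) = 0" by (simp add: algebra_simps)
    moreover have "q - inverse q \<noteq> 0" using assms(2,3) by (auto simp: field_simps power2_eq_square)
    ultimately show ?thesis by simp
  qed
  moreover have "\<phi> (oqm2_lin q (delta v)) = oqm2_lin q (\<lambda>k. w k * of_bool (k = \<sigma> v))" for v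
    using hbij \<sigma>(1,3) hw by (simp add: \<phi> BijGroup_def compose_def)
  moreover have "\<phi> \<one>\<^bsub>oqm2 q\<^esub> = \<one>\<^bsub>oqm2 q\<^esub>"
    using hbij \<sigma>(1) t1 one_closed ring_hom_one[OF hhom] by (simp add: \<phi> BijGroup_def compose_def)
  ultimately show thesis using that[OF \<sigma>(2), of w] \<alpha>(1) by (simp add: w_def)
qed

section \<open>Relations and skew primitive elements of a bosonization\<close>

lemma mult_group_order_gt_2:
  fixes a :: "'k::field"
  assumes a: "a \<in> carrier mult_group" and ord: "group.ord mult_group a \<ge> 2" "group.ord mult_group a \<noteq> 2"
  shows "a \<noteq> 0" "a \<noteq> 1" "a\<^sup>2 \<noteq> 1"
proof -
  let ?R = "ring_of_type_algebra :: 'k ring"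
  interpret R: ring ?R by (rule ring_from_type_algebra)
  interpret U: group "mult_group :: 'k monoid" by (rule R.units_group)
  have R: "\<one>\<^bsub>?R\<^esub> = 1" "x \<otimes>\<^bsub>?R\<^esub> y = x * y" for x y by (simp_all add: ring_of_type_algebra_def)
  show "a \<noteq> 0" using a by (auto simp: units_of_def Units_def R)
  have pow: "a [^]\<^bsub>mult_group\<^esub> n = a ^ n" for n :: nat
    by (induction n) (simp_all add: units_of_def R mult.commute)
  have dvd: "a ^ n = 1 \<longleftrightarrow> U.ord a dvd n" for n
    using U.pow_eq_id[OF a, of n] by (simp add: pow) (simp add: units_of_def R)
  show "a \<noteq> 1" using dvd[of 1] ord by auto
  have "\<not> U.ord a dvd 2" using ord by (auto dest: dvd_imp_le)
  then show "a\<^sup>2 \<noteq> 1" using dvd[of 2] by simp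
qed

text \<open>
  If \<open>s = t\<close>, the two terms merge into a single one with coefficient \<open>2\<close>, which is nonzero in
  characteristic zero.
\<close>

lemma sweedler_two_terms:
  fixes W :: "('k::field_char_0, 'w) module"
  assumes W: "k_algebra W" and s: "\<beta> (fst s) (snd s) \<in> carrier W" and t: "\<beta> (fst t) (snd t) \<in> carrier W"
  shows "sweedler W \<beta> (Poly_Mapping.single s 1 + Poly_Mapping.single t 1) =
    \<beta> (fst s) (snd s) \<oplus>\<^bsub>W\<^esub> \<beta> (fst t) (snd t)"
proof -
  interpret W: ring W using W by (simp add: k_algebra_def)
  note sc = k_algebra_scalars[OF W s] k_algebra_scalars[OF W t]
  show ?thesis
  proof (cases "s = t")
    case True
    have k: "Poly_Mapping.keys (Poly_Mapping.single t (2::'k)) = {t}" for t :: "'a \<times> 'b" by simp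
    have e: "Poly_Mapping.single s 1 + Poly_Mapping.single t 1 = Poly_Mapping.single t (2::'k)"
      using True by (simp flip: single_add)
    have "(2::'k) \<odot>\<^bsub>W\<^esub> \<beta> (fst t) (snd t) = \<beta> (fst t) (snd t) \<oplus>\<^bsub>W\<^esub> \<beta> (fst t) (snd t)"
      using sc(8)[of 1 1] sc(7) by simp
    then show ?thesis unfolding e sweedler_def using True t by simp
  next
    case False
    have k: "Poly_Mapping.keys (Poly_Mapping.single s (1::'k) + Poly_Mapping.single t 1) = {s, t}"
      using False by (auto simp: in_keys_iff lookup_add lookup_single when_def split: if_splits)
    have l: "Poly_Mapping.lookup (Poly_Mapping.single s (1::'k) + Poly_Mapping.single t 1) s = 1"
      "Poly_Mapping.lookup (Poly_Mapping.single s (1::'k) + Poly_Mapping.single t 1) t = 1"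
      using False by (auto simp: lookup_add lookup_single when_def)
    show ?thesis unfolding sweedler_def k using False s t sc(1,7) by (simp add: l)
  qed
qed

lemma pure_tensor_self: "Poly_Mapping.single (a, b) 1 \<in> pure_tensor A B a b"
  using zero_in_genideal[of "A \<times>\<times> B" "bilinear_rels A B"]
  by (force simp: pure_tensor_def quot_proj_def a_r_coset_def' monoid_algebra_simps)

lemma tensor_add_mem:
  "p \<in> P \<Longrightarrow> r \<in> R \<Longrightarrow> p + r \<in> P \<oplus>\<^bsub>tensor_algebra A B\<^esub> R"
  by (auto simp: tensor_algebra_def quot_algebra_def ring.defs module.defs FactRing_def
     set_add_def' monoid_algebra_simps)

lemma bos_rels_closed:
  assumes "comm_group G"
  shows "bos_rels G \<theta> g chi \<subseteq> carrier (free_algebra (bos_gens G \<theta>))"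
proof -
  interpret comm_group G by fact
  show ?thesis
    by (auto simp: bos_rels_def bos_gens_def monoid_algebra_simps free_monoid_simps in_keys_iff
      lookup_minus lookup_single when_def split: if_splits)
qed

lemma bos_relations:
  fixes G :: "('g, 'z) monoid_scheme" and \<theta> :: nat and g :: "nat \<Rightarrow> 'g" and chi :: "nat \<Rightarrow> 'g \<Rightarrow> 'k::field"
  assumes G: "comm_group G"
  defines "B \<equiv> bos_alg G \<theta> g chi" and "\<gamma> \<equiv> bos_grp G \<theta> g chi" and "x \<equiv> bos_x G \<theta> g chi"
  shows "h \<in> carrier G \<Longrightarrow> \<gamma> h \<in> carrier B"
    and "i \<in> {1..\<theta>} \<Longrightarrow> x i \<in> carrier B"
    and "h \<in> carrier G \<Longrightarrow> i \<in> {1..\<theta>} \<Longrightarrow> \<gamma> h \<otimes>\<^bsub>B\<^esub> x i = chi i h \<odot>\<^bsub>B\<^esub> (x i \<otimes>\<^bsub>B\<^esub> \<gamma> h)"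
    and "i \<in> {1..\<theta>} \<Longrightarrow> j \<in> {1..\<theta>} \<Longrightarrow> i \<noteq> j \<Longrightarrow>
      x i \<otimes>\<^bsub>B\<^esub> x j = chi j (g i) \<odot>\<^bsub>B\<^esub> (x j \<otimes>\<^bsub>B\<^esub> x i)"
proof -
  let ?V = "bos_gens G \<theta>" and ?R = "bos_rels G \<theta> g chi"
  interpret P: monoid_algebra_quotient "free_monoid ?V" ?R
    by (rule monoid_algebra_quotient.intro[OF monoid_free_monoid bos_rels_closed[OF G]])
  have B: "B = quot_algebra (free_algebra ?V) ?R"
    by (simp add: B_def bos_alg_def presented_algebra_def)
  have gen: "presented_gen ?V ?R v \<in> carrier B" if "v \<in> ?V" for v
    unfolding B presented_gen_def using that by (intro P.proj_closed P.single_closed) (simp add: free_monoid_simps)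
  have rel: "presented_gen ?V ?R u \<otimes>\<^bsub>B\<^esub> presented_gen ?V ?R v =
      c \<odot>\<^bsub>B\<^esub> (presented_gen ?V ?R u' \<otimes>\<^bsub>B\<^esub> presented_gen ?V ?R v')"
    if "u \<in> ?V" "v \<in> ?V" "u' \<in> ?V" "v' \<in> ?V"
      and r: "Poly_Mapping.single [u, v] 1 - Poly_Mapping.single [u', v'] c \<in> ?R" for u v u' v' c
  proof -
    have F: "Poly_Mapping.single [a] k \<in> carrier (free_algebra ?V)"
      "Poly_Mapping.single [a, b] k \<in> carrier (free_algebra ?V)" if "a \<in> ?V" "b \<in> ?V" for a b and k :: 'k
      using that by (simp_all add: P.single_closed free_monoid_simps)
    have prod: "presented_gen ?V ?R a \<otimes>\<^bsub>B\<^esub> presented_gen ?V ?R b = P.\<pi> (Poly_Mapping.single [a, b] 1)"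
      if "a \<in> ?V" "b \<in> ?V" for a b
      using that unfolding B presented_gen_def
      by (simp add: P.proj_mult F monoid_algebra_mult_single free_monoid_simps)
    have "P.\<pi> (Poly_Mapping.single [u, v] 1) = P.\<pi> (Poly_Mapping.single [u', v'] c)"
      using that ring.genideal_self[OF P.ring_F bos_rels_closed[OF G]]
      by (subst P.proj_eq_iff) (auto simp: F)
    also have "\<dots> = c \<odot>\<^bsub>B\<^esub> P.\<pi> (Poly_Mapping.single [u', v'] 1)"
      using that unfolding B by (simp add: P.proj_scale F map_scale_single)
    finally show ?thesis using that by (simp add: prod)
  qed
  show "h \<in> carrier G \<Longrightarrow> \<gamma> h \<in> carrier B" "i \<in> {1..\<theta>} \<Longrightarrow> x i \<in> carrier B"
    unfolding \<gamma>_def x_def bos_grp_def bos_x_def by (rule gen, simp add: bos_gens_def)+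
  show "h \<in> carrier G \<Longrightarrow> i \<in> {1..\<theta>} \<Longrightarrow> \<gamma> h \<otimes>\<^bsub>B\<^esub> x i = chi i h \<odot>\<^bsub>B\<^esub> (x i \<otimes>\<^bsub>B\<^esub> \<gamma> h)"
    unfolding \<gamma>_def x_def bos_grp_def bos_x_def
    by (rule rel) (auto simp: bos_gens_def bos_rels_def)
  show "i \<in> {1..\<theta>} \<Longrightarrow> j \<in> {1..\<theta>} \<Longrightarrow> i \<noteq> j \<Longrightarrow>
      x i \<otimes>\<^bsub>B\<^esub> x j = chi j (g i) \<odot>\<^bsub>B\<^esub> (x j \<otimes>\<^bsub>B\<^esub> x i)"
    unfolding x_def bos_x_def
    by (rule rel) (auto simp: bos_gens_def bos_rels_def)
qed

text \<open>
  The axiom for module algebras may be evaluated at any representative of \<open>\<Delta>(x)\<close>, in particular at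
  \<open>\<gamma> \<otimes> x + x \<otimes> 1\<close>.
\<close>

lemma skew_primitive_acts:
  fixes R :: "('k::field_char_0, 'r) module"
  assumes act: "module_algebra H \<Delta> \<epsilon> R act" and H: "k_algebra H" and x: "x \<in> carrier H" and \<gamma>: "\<gamma> \<in> carrier H"
    and \<Delta>: "\<Delta> x = pure_tensor H H \<gamma> x \<oplus>\<^bsub>tensor_algebra H H\<^esub> pure_tensor H H x \<one>\<^bsub>H\<^esub>"
    and a: "a \<in> carrier R" and b: "b \<in> carrier R"
  shows "act x (a \<otimes>\<^bsub>R\<^esub> b) = (act \<gamma> a \<otimes>\<^bsub>R\<^esub> act x b) \<oplus>\<^bsub>R\<^esub> (act x a \<otimes>\<^bsub>R\<^esub> b)"
proof -
  have R: "k_algebra R" using act by (simp add: module_algebra_def)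
  interpret R: ring R using R by (simp add: k_algebra_def)
  interpret H: ring H using H by (simp add: k_algebra_def)
  have closed: "act h c \<in> carrier R" if "h \<in> carrier H" "c \<in> carrier R" for h c
    using act that by (auto simp: module_algebra_def lin_map_def)
  let ?p = "Poly_Mapping.single (\<gamma>, x) 1 + Poly_Mapping.single (x, \<one>\<^bsub>H\<^esub>) (1::'k)"
  have "?p \<in> \<Delta> x" unfolding \<Delta> by (intro tensor_add_mem pure_tensor_self)
  then have "act x (a \<otimes>\<^bsub>R\<^esub> b) = sweedler R (\<lambda>u v. act u a \<otimes>\<^bsub>R\<^esub> act v b) ?p"
    using act x a b by (simp add: module_algebra_def)
  also have "\<dots> = (act \<gamma> a \<otimes>\<^bsub>R\<^esub> act x b) \<oplus>\<^bsub>R\<^esub> (act x a \<otimes>\<^bsub>R\<^esub> act \<one>\<^bsub>H\<^esub> b)"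
    using closed x \<gamma> a b by (subst sweedler_two_terms[OF R]) auto
  also have "act \<one>\<^bsub>H\<^esub> b = b" using act b by (simp add: module_algebra_def)
  finally show ?thesis .
qed

text \<open>
  Since \<open>x\<close> acts on \<open>1\<close> by a scalar, the result is fixed by \<open>\<gamma>\<close>; but moving \<open>\<gamma>\<close> past \<open>x\<close> multiplies it by
  \<open>lam \<noteq> 1\<close>.
\<close>

lemma skew_primitive_kills_one:
  assumes act: "module_algebra H \<Delta> \<epsilon> R act" and H: "k_algebra H" and x: "x \<in> carrier H" and \<gamma>: "\<gamma> \<in> carrier H"
    and comm: "\<gamma> \<otimes>\<^bsub>H\<^esub> x = lam \<odot>\<^bsub>H\<^esub> (x \<otimes>\<^bsub>H\<^esub> \<gamma>)" and lam: "lam \<noteq> 1"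
    and \<gamma>1: "act \<gamma> \<one>\<^bsub>R\<^esub> = \<one>\<^bsub>R\<^esub>"
  shows "act x \<one>\<^bsub>R\<^esub> = \<zero>\<^bsub>R\<^esub>"
proof -
  have R: "k_algebra R" using act by (simp add: module_algebra_def)
  interpret R: ring R using R by (simp add: k_algebra_def)
  interpret H: ring H using H by (simp add: k_algebra_def)
  have lin: "act h \<in> lin_map R R" if "h \<in> carrier H" for h
    using act that by (simp add: module_algebra_def)
  have lin': "(\<lambda>h. act h a) \<in> lin_map H R" if "a \<in> carrier R" for a
    using act that by (simp add: module_algebra_def)
  have comp: "act (h \<otimes>\<^bsub>H\<^esub> h') a = act h (act h' a)" if "h \<in> carrier H" "h' \<in> carrier H" "a \<in> carrier R" for h h' a
    using act that by (simp add: module_algebra_def)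
  define y where "y = act x \<one>\<^bsub>R\<^esub>"
  have y: "y \<in> carrier R" using lin[OF x] by (auto simp: y_def lin_map_def)
  have y_eq: "y = \<epsilon> x \<odot>\<^bsub>R\<^esub> \<one>\<^bsub>R\<^esub>" using act x by (simp add: y_def module_algebra_def)
  have "y = act \<gamma> y"
    unfolding y_eq using lin[OF \<gamma>] \<gamma>1 by (simp add: lin_map_def)
  also have "\<dots> = act (\<gamma> \<otimes>\<^bsub>H\<^esub> x) \<one>\<^bsub>R\<^esub>" by (simp add: comp x \<gamma> y_def)
  also have "\<dots> = lam \<odot>\<^bsub>R\<^esub> act (x \<otimes>\<^bsub>H\<^esub> \<gamma>) \<one>\<^bsub>R\<^esub>"
    unfolding comm using lin'[OF R.one_closed] x \<gamma> by (simp add: lin_map_def)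
  also have "\<dots> = lam \<odot>\<^bsub>R\<^esub> y" by (simp add: comp x \<gamma> y_def \<gamma>1)
  finally have lam_y: "lam \<odot>\<^bsub>R\<^esub> y = y" by simp
  note sc = k_algebra_scalars[OF R]
  have "y = (1 - lam) \<odot>\<^bsub>R\<^esub> y \<oplus>\<^bsub>R\<^esub> lam \<odot>\<^bsub>R\<^esub> y"
    using sc(2)[OF y, of "1 - lam" lam] sc(1)[OF y] by simp
  then have "(1 - lam) \<odot>\<^bsub>R\<^esub> y = \<zero>\<^bsub>R\<^esub>"
    using lam_y y sc(6)[OF y] by (metis R.add.r_cancel_one')
  then have "(inverse (1 - lam) * (1 - lam)) \<odot>\<^bsub>R\<^esub> y = \<zero>\<^bsub>R\<^esub>"
    using sc(3)[OF y] sc(4)[OF y] by simp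
  then show ?thesis using lam sc(1)[OF y] by (simp add: y_def)
qed

section \<open>Skew derivations that act linearly\<close>

text \<open>
  Matrices are indexed so that \<open>U k v\<close> is the coefficient of \<open>Y\<^sub>k\<close> in the image of \<open>Y\<^sub>v\<close>. With \<open>W\<close> for
  \<open>g\<close> and \<open>U\<close> for \<open>x\<close>, the formula is \<open>x(Y\<^sub>u Y\<^sub>v) = g(Y\<^sub>u) x(Y\<^sub>v) + x(Y\<^sub>u) Y\<^sub>v\<close>, extended to \<open>\<Sum> c u v Y\<^sub>u Y\<^sub>v\<close>.
\<close>

definition skew_image ::
  "(2 \<times> 2 \<Rightarrow> 2 \<times> 2 \<Rightarrow> 'k::field) \<Rightarrow> (2 \<times> 2 \<Rightarrow> 2 \<times> 2 \<Rightarrow> 'k) \<Rightarrow> (2 \<times> 2 \<Rightarrow> 2 \<times> 2 \<Rightarrow> 'k) \<Rightarrow>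
   (2 \<times> 2 \<Rightarrow> 2 \<times> 2 \<Rightarrow> 'k)" where
  "skew_image W U c k l =
     (\<Sum>u\<in>UNIV. \<Sum>v\<in>UNIV. c u v * (W k u * U l v + U k u * of_bool (l = v)))"

definition skew_derivation ::
  "'k::field \<Rightarrow> (2 \<times> 2 \<Rightarrow> 2 \<times> 2 \<Rightarrow> 'k) \<Rightarrow> (2 \<times> 2 \<Rightarrow> 2 \<times> 2 \<Rightarrow> 'k) \<Rightarrow> bool" where
  "skew_derivation q W U \<longleftrightarrow> (\<forall>c. oqm2_quad_zero q c \<longrightarrow> oqm2_quad_zero q (skew_image W U c))"

lemma skew_image_sum3:
  "skew_image W U (\<lambda>u v. a * of_bool (u = u1 \<and> v = v1) + b * of_bool (u = u2 \<and> v = v2) + c * of_bool (u = u3 \<and> v = v3)) k l = 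
   a * (W k u1 * U l v1 + U k u1 * of_bool (l = v1))
   + b * (W k u2 * U l v2 + U k u2 * of_bool (l = v2)) + c * (W k u3 * U l v3 + U k u3 * of_bool (l = v3))"
proof -
  have "(\<Sum>u\<in>UNIV. \<Sum>v\<in>UNIV. (e * of_bool (u = u0 \<and> v = v0)) * f u v) = e * f u0 v0"
    for e u0 v0 and f :: "2 \<times> 2 \<Rightarrow> 2 \<times> 2 \<Rightarrow> 'a"
  proof -
    have "(\<Sum>v\<in>UNIV. (e * of_bool (u = u0 \<and> v = v0)) * f u v) = (if u = u0 then e * f u0 v0 else 0)" for u
    proof -
      have "(\<Sum>v\<in>UNIV. (e * of_bool (u = u0 \<and> v = v0)) * f u v) =
          (\<Sum>v\<in>UNIV. if v = v0 then e * of_bool (u = u0) * f u v0 else 0)"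
        by (intro sum.cong refl) (simp add: of_bool_def)
      then show ?thesis by simp
    qed
    then show ?thesis by simp
  qed
  then show ?thesis unfolding skew_image_def distrib_right sum.distrib by simp
qed

text \<open>
  Three terms suffice, since no defining relation has more.
\<close>

lemma skew_derivation_eqs:
  assumes "skew_derivation q W U"
    and "oqm2_quad_zero q (\<lambda>u v. a * of_bool (u = u1 \<and> v = v1) + b * of_bool (u = u2 \<and> v = v2) + c * of_bool (u = u3 \<and> v = v3))"
  shows "oqm2_quad_zero q (\<lambda>k l. a * (W k u1 * U l v1 + U k u1 * of_bool (l = v1))
   + b * (W k u2 * U l v2 + U k u2 * of_bool (l = v2)) + c * (W k u3 * U l v3 + U k u3 * of_bool (l = v3)))"
  using assms unfolding skew_derivation_def skew_image_sum3[symmetric] by blast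

lemma all_letters: "(\<forall>v. P v) \<longleftrightarrow> P LA \<and> P LB \<and> P LC \<and> P LD"
  using UNIV_letters by (metis (no_types, opaque_lifting) UNIV_I empty_iff insert_iff)

text \<open>
  If \<open>g\<close> exchanges \<open>B\<close> and \<open>C\<close> up to scalars, the relations leave only the block of \<open>x\<close> on the span of
  \<open>B\<close> and \<open>C\<close>. There the eigenvalues of \<open>g\<close> are \<open>s\<close> and \<open>-s\<close> for some \<open>s\<close>, while \<open>x\<close> multiplies
  eigenvalues by \<open>lam\<close>, which differs from \<open>1\<close> and \<open>-1\<close>.
\<close>

lemma twisted_skew_derivation_eq_0:
  fixes q lam :: "'k::field"
  assumes q: "q \<noteq> 0" "q^2 \<noteq> 1"
    and skew: "skew_derivation q (\<lambda>k u. w k * of_bool (k = prod.swap u)) U"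
    and w: "\<And>k. w k \<noteq> 0"
    and weight: "\<And>k l. w k * U (prod.swap k) l = lam * (U k (prod.swap l) * w (prod.swap l))"
    and lam: "lam \<noteq> 1" "lam^2 \<noteq> 1"
  shows "U k l = 0"
proof -
  have diag: "U LA LA = 0" "U LD LD = 0"
    using weight[of LA LA] weight[of LD LD] w lam(1) by auto
  have q1: "q \<noteq> 1" "q * q \<noteq> 1" "inverse q \<noteq> q" "q - inverse q \<noteq> 0"
    using q by (auto simp: power2_eq_square field_simps)
  have lamsq: "x = 0" if "x = lam * y" "y = lam * x" for x y
    using that lam(2) by (metis mult.assoc mult_cancel_right1 power2_eq_square)
  note e = skew_derivation_eqs[OF skew]
  have AB: "U LB LA = 0" "U LC LA = 0" "U LD LA = 0" "U LD LB = 0"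
    using e[of 1 LA LB "-q" LB LA 0 LA LA] q q1 w by (auto simp: oqm2_quad_zero_def diag)
  have AC: "U LD LC = 0"
    using e[of 1 LA LC "-q" LC LA 0 LA LA] q q1 w by (auto simp: oqm2_quad_zero_def diag AB)
  have BD: "U LA LD = 0" "U LB LD = 0" "U LC LD = 0" "U LA LB = 0"
    using e[of 1 LB LD "-q" LD LB 0 LA LA] q q1 w by (auto simp: oqm2_quad_zero_def diag AB AC)
  have CD: "U LA LC = 0"
    using e[of 1 LC LD "-q" LD LC 0 LA LA] q q1 w by (auto simp: oqm2_quad_zero_def diag AB AC BD)
  have "w LB * U LC LB = lam * (w LC * U LB LC)" "w LC * U LB LC = lam * (w LB * U LC LB)"
    using weight[of LB LB] weight[of LC LC] by (simp_all add: ac_simps)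
  then have off_diag: "U LB LC = 0" "U LC LB = 0"
    using lamsq[of "w LB * U LC LB" "w LC * U LB LC"] lamsq[of "w LC * U LB LC" "w LB * U LC LB"] w by auto
  have "w LB * U LC LC = w LB * (lam * U LB LB)" "w LC * U LB LB = w LC * (lam * U LC LC)"
    using weight[of LB LC] weight[of LC LB] by (simp_all add: ac_simps)
  then have "U LC LC = lam * U LB LB" "U LB LB = lam * U LC LC"
    using w[of LB] w[of LC] by (simp_all only: mult_cancel_left simp_thms)
  then have "U LB LB = 0" "U LC LC = 0" using lamsq by blast+
  then have "\<forall>k l. U k l = 0"
    using diag AB AC BD CD off_diag by (simp add: all_letters del: split_paired_All)
  then show ?thesis by blast
qed

datatype skew_kind = Column_Shift | Row_Shift | Corner | From_A | From_D

definition supported_on :: "(2 \<times> 2 \<Rightarrow> 2 \<times> 2 \<Rightarrow> 'k::zero) \<Rightarrow> ((2 \<times> 2) \<times> (2 \<times> 2)) set \<Rightarrow> bool" where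
  "supported_on U S \<longleftrightarrow> (\<forall>k l. (k, l) \<notin> S \<longrightarrow> U k l = 0)"

text \<open>
  The possible matrices of a skew primitive element. Besides the support, a rule records what is needed
  to compare two operators of the same kind, namely \<open>lam\<close> (with inverse powers of \<open>q\<close> cleared) and, where
  the image of \<open>A\<close> or \<open>D\<close> may involve both \<open>B\<close> and \<open>C\<close>, that these have the same weight. The entries in
  the rules for \<open>Corner\<close> that are not required to be nonzero do occur for \<open>q\<^sup>3 = 1\<close>.
\<close>

inductive has_kind ::
  "'k::field \<Rightarrow> 'k \<Rightarrow> (2 \<times> 2 \<Rightarrow> 'k) \<Rightarrow> (2 \<times> 2 \<Rightarrow> 2 \<times> 2 \<Rightarrow> 'k) \<Rightarrow> skew_kind \<Rightarrow> bool"
  for q lam w U where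
  column_right: "supported_on U {(LB, LA), (LD, LC)} \<Longrightarrow> U LB LA = U LD LC \<Longrightarrow> U LB LA \<noteq> 0 \<Longrightarrow>
    lam * q^2 = 1 \<Longrightarrow> has_kind q lam w U Column_Shift"
| column_left: "supported_on U {(LA, LB), (LC, LD)} \<Longrightarrow> U LA LB = U LC LD \<Longrightarrow> U LA LB \<noteq> 0 \<Longrightarrow>
    lam = q^2 \<Longrightarrow> has_kind q lam w U Column_Shift"
| row_down: "supported_on U {(LC, LA), (LD, LB)} \<Longrightarrow> U LC LA = U LD LB \<Longrightarrow> U LC LA \<noteq> 0 \<Longrightarrow>
    lam * q^2 = 1 \<Longrightarrow> has_kind q lam w U Row_Shift"
| row_up: "supported_on U {(LA, LC), (LB, LD)} \<Longrightarrow> U LA LC = U LB LD \<Longrightarrow> U LA LC \<noteq> 0 \<Longrightarrow>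
    lam = q^2 \<Longrightarrow> has_kind q lam w U Row_Shift"
| corner_A: "supported_on U {(LD, LA), (LB, LD), (LC, LD)} \<Longrightarrow> U LD LA \<noteq> 0 \<Longrightarrow>
    lam = q^4 \<Longrightarrow> has_kind q lam w U Corner"
| corner_D: "supported_on U {(LA, LD), (LB, LA), (LC, LA)} \<Longrightarrow> U LA LD \<noteq> 0 \<Longrightarrow>
    lam * q^4 = 1 \<Longrightarrow> has_kind q lam w U Corner"
| from_A: "supported_on U {(LB, LA), (LC, LA)} \<Longrightarrow> U LB LA \<noteq> 0 \<or> U LC LA \<noteq> 0 \<Longrightarrow>
    w LB = w LC \<Longrightarrow> lam = q^2 \<Longrightarrow> has_kind q lam w U From_A"
| from_D: "supported_on U {(LB, LD), (LC, LD)} \<Longrightarrow> U LB LD \<noteq> 0 \<or> U LC LD \<noteq> 0 \<Longrightarrow>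
    w LB = w LC \<Longrightarrow> lam * q^2 = 1 \<Longrightarrow> has_kind q lam w U From_D"

text \<open>
  An entry \<open>U k l \<noteq> 0\<close> forces \<open>w k = lam * w l\<close>. As \<open>lam\<close> and \<open>lam\<^sup>2\<close> differ from \<open>1\<close>, diagonal entries
  vanish, and so does one of any two opposite entries. Applied to the defining relations, \<open>U\<close> yields
  equations of the form "an entry vanishes or a weight has a given value", and a few that couple two
  entries. In each case of the proof a nonzero entry fixes enough weights to make most others
  impossible.
\<close>

lemma diagonal_skew_derivation_kind:
  fixes q lam :: "'k::field"
  assumes q: "q \<noteq> 0" "q^2 \<noteq> 1"
    and skew: "skew_derivation q (\<lambda>k u. w k * of_bool (k = u)) U"
    and w: "\<And>k. w k \<noteq> 0" "w LA * w LD = w LB * w LC"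
    and weight: "\<And>k l. U k l \<noteq> 0 \<Longrightarrow> w k = lam * w l"
    and lam: "lam \<noteq> 1" "lam^2 \<noteq> 1"
    and U: "\<exists>k l. U k l \<noteq> 0"
  shows "\<exists>\<kappa>. has_kind q lam w U \<kappa>"
proof -
  have diag: "U k k = 0" for k
    using weight[of k k] w(1)[of k] lam(1) by auto
  have anti: "U l k = 0" if "U k l \<noteq> 0" for k l
  proof (rule ccontr)
    assume "U l k \<noteq> 0"
    then have "w k = lam^2 * w k" using weight[OF that] weight[of l k] by (simp add: power2_eq_square)
    then show False using w(1)[of k] lam(2) by simp
  qed
  have q1: "q \<noteq> 1" "q * q \<noteq> 1" "inverse q \<noteq> q" "q - inverse q \<noteq> 0"
    using q by (auto simp: power2_eq_square field_simps)
  note e = skew_derivation_eqs[OF skew]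
  (* The facts are named after the left-hand side of the relation to which x is applied. *)
  have AB: "U LA LB = 0 \<or> w LA = q" "U LB LA = 0 \<or> q * w LB = 1" "U LD LA = 0 \<or> q * (q * w LB) = 1"
      "U LD LB = 0 \<or> w LA = q"
      "U LC LA - q * (w LB * U LC LA) + (q - inverse q) * (w LA * U LD LB) = 0"
    using e[of 1 LA LB "-q" LB LA 0 LA LA] by (simp_all add: oqm2_quad_zero_def diag)
  have AC: "U LA LC = 0 \<or> w LA = q" "U LC LA = 0 \<or> q * w LC = 1" "U LD LA = 0 \<or> q * (q * w LC) = 1"
    "U LD LC = 0 \<or> w LA = q"
    "U LB LA - q * (w LC * U LB LA) + (q - inverse q) * (w LA * U LD LC) = 0"
    using e[of 1 LA LC "-q" LC LA 0 LA LA] by (simp_all add: oqm2_quad_zero_def diag)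
  have BD: "U LB LD = 0 \<or> w LB = q" "U LD LB = 0 \<or> q * w LD = 1" "U LA LD = 0 \<or> w LB = q * q"
    "U LA LB = 0 \<or> q * w LD = 1" 
    "w LB * U LC LD - q * U LC LD + (q - inverse q) * U LA LB = 0"
    using e[of 1 LB LD "-q" LD LB 0 LA LA] by (simp_all add: oqm2_quad_zero_def diag)
  have CD: "U LC LD = 0 \<or> w LC = q" "U LD LC = 0 \<or> q * w LD = 1" "U LA LD = 0 \<or> w LC = q * q"
    "U LA LC = 0 \<or> q * w LD = 1"
    "w LC * U LB LD - q * U LB LD + (q - inverse q) * U LA LC = 0"
    using e[of 1 LC LD "-q" LD LC 0 LA LA] by (simp_all add: oqm2_quad_zero_def diag)
  have BC: "U LA LC = 0 \<or> w LB = q" "U LA LB = 0 \<or> q = w LC" "U LD LC = 0 \<or> q * w LB = 1"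
    "U LD LB = 0 \<or> q * w LC = 1"
    using e[of 1 LB LC "-1" LC LB 0 LA LA] by (simp_all add: oqm2_quad_zero_def diag)
  have AD: "U LA LD = 0 \<or> w LA = 1" "U LD LA = 0 \<or> w LD = 1" "U LB LC = 0" "U LC LB = 0"
     "q * (w LA * U LB LD) + ((inverse q - q) * (w LB * U LA LC) - U LB LD) = 0"
     "q * (w LA * U LC LD + (inverse q - q) * U LA LB) = U LC LD"
     "q * (U LB LA + (inverse q - q) * (w LB * U LD LC)) = w LD * U LB LA"
     "q * U LC LA + ((inverse q - q) * U LD LB - w LD * U LC LA) = 0"
    using e[of 1 LA LD "-1" LD LA "inverse q - q" LB LC] w(1)[of LB] q1
    by (simp_all add: oqm2_quad_zero_def diag)
  note supp = supported_on_def all_letters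
  consider "U LD LA \<noteq> 0" | "U LA LD \<noteq> 0" | "U LD LA = 0" "U LA LD = 0" by blast
  then show ?thesis
  proof cases
    case 1
    have c: "w LD = 1" "q * (q * w LB) = 1" "q * (q * w LC) = 1" "w LD = lam * w LA"
      using 1 AB(3) AC(3) AD(2) weight[OF 1] by simp_all
    have "q * w LB \<noteq> 1" "q * w LC \<noteq> 1" "q * w LD \<noteq> 1" using c q1 by auto
    then have z: "U LB LA = 0" "U LC LA = 0" "U LD LB = 0" "U LD LC = 0" "U LA LB = 0" "U LA LC = 0"
      using AB AC BD CD BC by auto
    have "lam = lam * ((q * (q * w LB)) * (q * (q * w LC)))" using c by simp
    also have "\<dots> = lam * w LA * w LD * q^4" using w(2) by (simp add: power4_eq_xxxx ac_simps)
    also have "\<dots> = q^4" using c by simp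
    finally show ?thesis
      using 1 z diag AD(3,4) anti[OF 1] by - (rule exI, rule has_kind.corner_A, auto simp: supp simp del: split_paired_All)
  next
    case 2
    have c: "w LA = 1" "w LB = q * q" "w LC = q * q" "w LA = lam * w LD"
      using 2 BD(3) CD(3) AD(1) weight[OF 2] by simp_all
    have "w LA \<noteq> q" "w LB \<noteq> q" "w LC \<noteq> q" using c q1 q by auto
    then have z: "U LB LD = 0" "U LC LD = 0" "U LD LB = 0" "U LD LC = 0" "U LA LB = 0" "U LA LC = 0"
      using AB AC BD CD BC by auto
    have "w LD = q^4" using w(2) c by (simp add: power4_eq_xxxx ac_simps)
    then have "lam * q^4 = 1" using c by simp
    then show ?thesis
      using 2 z diag AD(3,4) anti[OF 2] by - (rule exI, rule has_kind.corner_D, auto simp: supp simp del: split_paired_All)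
  next
    case 3
    note out = 3
    consider "U LD LB \<noteq> 0" | "U LD LC \<noteq> 0" | "U LA LB \<noteq> 0" | "U LA LC \<noteq> 0" 
     | "U LD LB = 0" "U LD LC = 0" "U LA LB = 0" "U LA LC = 0" by blast
    then show ?thesis
    proof cases
      case 1
      have c: "w LA = q" "q * w LD = 1" "q * w LC = 1" "w LD = lam * w LB"
        using 1 AB(4) BD(2) BC(4) weight[OF 1] by simp_all
      (* Here q w(C) = 1 = q w(D), so w(A) w(D) = w(B) w(C) determines w(B). *)
      have "w LB = w LB * (q * w LC)" by (simp add: c(3))
      also have "\<dots> = w LA * (q * w LD)" using w(2) by (simp add: ac_simps)
      finally have wB: "w LB = q" by (simp add: c(1,2))
      have ne: "w LC \<noteq> q" "q * w LB \<noteq> 1" using c wB q1 by auto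
      have "(1 - q * q) * (U LC LA - U LD LB) = 0"
        using AB(5) c wB q by (simp add: algebra_simps)
      then have eq: "U LC LA = U LD LB" using q1 by simp
      have "lam * q^2 = q * w LD" unfolding c(4) wB by (simp add: power2_eq_square ac_simps)
      moreover have "U LA LB = 0" "U LB LA = 0" "U LD LC = 0" "U LB LD = 0" "U LC LD = 0" "U LA LC = 0"
        using BC(2) AB(2) BC(3) CD(1) ne anti[OF 1] anti[of LC LA] eq 1 by auto
      ultimately show ?thesis
        using 1 out eq c(2) diag AD(3,4) by - (rule exI, rule has_kind.row_down, auto simp: supp simp del: split_paired_All)
    next
      case 2
      have c: "w LA = q" "q * w LD = 1" "q * w LB = 1" "w LD = lam * w LC"
        using 2 AC(4) CD(2) BC(3) weight[OF 2] by simp_all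
      have "w LC = w LC * (q * w LB)" by (simp add: c(3))
      also have "\<dots> = w LA * (q * w LD)" using w(2) by (simp add: ac_simps)
      finally have wB: "w LC = q" by (simp add: c(1,2))
      have ne: "w LB \<noteq> q" "q * w LC \<noteq> 1" using c wB q1 by auto
      have "(1 - q * q) * (U LB LA - U LD LC) = 0"
        using AC(5) c wB q by (simp add: algebra_simps)
      then have eq: "U LB LA = U LD LC" using q1 by simp
      have "lam * q^2 = q * w LD" unfolding c(4) wB by (simp add: power2_eq_square ac_simps)
      moreover have "U LA LC = 0" "U LC LA = 0" "U LD LB = 0" "U LC LD = 0" "U LB LD = 0" "U LA LB = 0"
        using BC(1) AC(2) BC(4) BD(1) ne anti[OF 2] anti[of LB LA] eq 2 by auto
      ultimately show ?thesis
        using 2 out eq c(2) diag AD(3,4) by - (rule exI, rule has_kind.column_right, auto simp: supp simp del: split_paired_All)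
    next
      case 3
      have c: "w LA = q" "q * w LD = 1" "w LC = q" "w LA = lam * w LB"
        using 3 AB(1) BD(4) BC(2) weight[OF 3] by simp_all
      have wB: "q * w LB = 1" using w(2) c by (simp add: ac_simps)
      have ne: "w LB \<noteq> q" "q * w LC \<noteq> 1" using c wB q1 by auto
      have "(w LB - q) * (U LC LD - U LA LB) = 0"
      proof -
        have "inverse q = w LB" using wB q by (simp add: field_simps)
        then show ?thesis using BD(5) by (simp add: algebra_simps)
      qed
      then have eq: "U LA LB = U LC LD" using ne by simp
      have "lam = q^2" using c wB by (metis mult.assoc mult.commute mult_1_right power2_eq_square)
      moreover have "U LA LC = 0" "U LC LA = 0" "U LD LB = 0" "U LD LC = 0" "U LB LD = 0" "U LB LA = 0"
        using BC(1) AC(2) BC(4) BD(1) ne anti[OF 3] anti[of LC LD] eq 3 by auto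
      ultimately show ?thesis
        using 3 out eq c diag AD(3,4) by - (rule exI, rule has_kind.column_left, auto simp: supp simp del: split_paired_All)
    next
      case 4
      have c: "w LA = q" "q * w LD = 1" "w LB = q" "w LA = lam * w LC"
        using 4 AC(1) CD(4) BC(1) weight[OF 4] by simp_all
      have wB: "q * w LC = 1" using w(2) c by (simp add: ac_simps)
      have ne: "w LC \<noteq> q" "q * w LB \<noteq> 1" using c wB q1 by auto
      have "(w LC - q) * (U LB LD - U LA LC) = 0"
      proof -
        have "inverse q = w LC" using wB q by (simp add: field_simps)
        then show ?thesis using CD(5) by (simp add: algebra_simps)
      qed
      then have eq: "U LA LC = U LB LD" using ne by simp
      have "lam = q^2" using c wB by (metis mult.assoc mult.commute mult_1_right power2_eq_square)
      moreover have "U LA LB = 0" "U LB LA = 0" "U LD LC = 0" "U LD LB = 0" "U LC LD = 0" "U LC LA = 0"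
        using BC(2) AB(2) BC(3) CD(1) ne anti[OF 4] anti[of LB LD] eq 4 by auto
      ultimately show ?thesis
        using 4 out eq c diag AD(3,4) by - (rule exI, rule has_kind.row_up, auto simp: supp simp del: split_paired_All)
    next
      case 5
      have cases: "(U LB LA \<noteq> 0 \<or> U LC LA \<noteq> 0) \<or> (U LB LD \<noteq> 0 \<or> U LC LD \<noteq> 0)"
      proof (rule ccontr)
        assume "\<not> ?thesis"
        then have "\<forall>k l. U k l = 0" using out 5 diag AD(3,4) by (simp add: all_letters del: split_paired_All)
        then show False using U by blast
      qed
      show ?thesis
      proof (cases "U LB LA \<noteq> 0 \<or> U LC LA \<noteq> 0")
        case True
        have "(1 - q * w LB) * U LC LA = 0" "(1 - q * w LC) * U LB LA = 0"
          using AB(5) AC(5) 5 by (simp_all add: algebra_simps)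
        then have c: "q * w LB = 1" "q * w LC = 1" using True AB(2) AC(2) by auto
        have "(q - w LD) * U LB LA = 0" "(q - w LD) * U LC LA = 0"
          using AD(7,8) 5 by (simp_all add: algebra_simps)
        then have wD: "w LD = q" using True by auto
        have wBC: "w LB = w LC" using c q by (metis mult_cancel_left)
        have "w LB = lam * w LA" using True weight[of LB LA] weight[of LC LA] wBC by auto
        then have "w LB * w LD = (lam * w LC) * w LB" using w(2) by (simp add: ac_simps)
        then have "lam * w LC = q" using w(1)[of LB] wD by simp
        then have "lam = q^2" using c by (metis mult.assoc mult.commute mult_1_right power2_eq_square)
        moreover have "w LB \<noteq> q" "w LC \<noteq> q" using c q1 by auto
        then have "U LB LD = 0" "U LC LD = 0" using BD(1) CD(1) by auto
        ultimately show ?thesis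
          using True out 5 wBC diag AD(3,4) by - (rule exI, rule has_kind.from_A, auto simp: supp simp del: split_paired_All)
      next
        case False
        then have nz: "U LB LD \<noteq> 0 \<or> U LC LD \<noteq> 0" using cases by blast
        have "(w LB - q) * U LC LD = 0" "(w LC - q) * U LB LD = 0"
          using BD(5) CD(5) 5 by (simp_all add: algebra_simps)
        then have c: "w LB = q" "w LC = q" using nz BD(1) CD(1) by auto
        have "(q * w LA - 1) * U LB LD = 0" "(q * w LA - 1) * U LC LD = 0"
          using AD(5,6) 5 by (simp_all add: algebra_simps)
        then have wA: "q * w LA = 1" using nz by auto
        have "w LB = lam * w LD" using nz weight[of LB LD] weight[of LC LD] c by auto
        then have "w LB * w LA = (lam * w LC) * w LB" using w(2) by (simp add: ac_simps)
        then have "lam * w LC = w LA" using w(1)[of LB] by simp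
        then have "lam * q^2 = 1" using c wA by (metis mult.assoc mult.commute power2_eq_square)
        then show ?thesis
          using False nz out 5 c diag AD(3,4) by - (rule exI, rule has_kind.from_D, auto simp: supp simp del: split_paired_All)
      qed
    qed
  qed
qed

section \<open>Pairs of commuting skew derivations\<close>

text \<open>
  The relations of the bosonization between two skew primitive generators \<open>x\<^sub>1, x\<^sub>2\<close> and their group
  elements \<open>g\<^sub>1, g\<^sub>2\<close>, with \<open>xi = \<chi>\<^sub>2(g\<^sub>1)\<close> and hence \<open>\<chi>\<^sub>1(g\<^sub>2) = 1 / xi\<close>.
\<close>

locale skew_pair =
  fixes q :: "'k::field" and xi lam1 lam2 :: 'k and w1 w2 :: "2 \<times> 2 \<Rightarrow> 'k"
    and U1 U2 :: "2 \<times> 2 \<Rightarrow> 2 \<times> 2 \<Rightarrow> 'k"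
  assumes q: "q \<noteq> 0" and xi: "xi \<noteq> 0"
    and w1: "\<And>k. w1 k \<noteq> 0" and w2: "\<And>k. w2 k \<noteq> 0"
    and lam1: "lam1^2 \<noteq> 1"
    and weight1: "\<And>k l. U1 k l \<noteq> 0 \<Longrightarrow> w1 k = lam1 * w1 l"
    and weight2: "\<And>k l. U2 k l \<noteq> 0 \<Longrightarrow> w2 k = lam2 * w2 l"
    and weight12: "\<And>k l. U2 k l \<noteq> 0 \<Longrightarrow> w1 k = xi * w1 l"
    and weight21: "\<And>k l. U1 k l \<noteq> 0 \<Longrightarrow> xi * w2 k = w2 l"
    and comp: "\<And>k l. (\<Sum>m\<in>UNIV. U1 k m * U2 m l) = xi * (\<Sum>m\<in>UNIV. U2 k m * U1 m l)"
begin

text \<open>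
  The weights of \<open>g\<^sub>1\<close> show \<open>xi = lam1\<close>, those of \<open>g\<^sub>2\<close> show \<open>1 / xi = lam2\<close>. The rows \<open>k\<close> and \<open>k'\<close> may
  differ because of operators that send \<open>A\<close> or \<open>D\<close> into the span of \<open>B\<close> and \<open>C\<close>.
\<close>

lemma common_entry:
  assumes "U1 k l \<noteq> 0" "U2 k' l \<noteq> 0" "w1 k' = w1 k" "w2 k' = w2 k"
  shows "lam1 * lam2 = 1"
proof -
  have "xi = lam1" 
    using weight1[OF assms(1)] weight12[OF assms(2)] assms(3) w1[of l] by simp
  moreover have "xi * (lam2 * w2 l) = w2 l"
    using weight2[OF assms(2)] weight21[OF assms(1)] assms(4) by simp
  ultimately show ?thesis using w2[of l] by simp
qed

lemma comp_expanded:
  "U1 k LA * U2 LA l + U1 k LB * U2 LB l + U1 k LC * U2 LC l + U1 k LD * U2 LD l =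
    xi * (U2 k LA * U1 LA l + U2 k LB * U1 LB l + U2 k LC * U1 LC l + U2 k LD * U1 LD l)"
  using comp[of k l] by (simp only: sum_letters)

text \<open>
  Two operators with the same direction have equal \<open>lam\<close> and a common nonzero entry (or entries in the
  same column and in rows of equal weight), so the square of \<open>lam1\<close> would be \<open>1\<close>. For opposite
  directions, exactly one of the two compositions has a nonzero diagonal entry at \<open>A\<close>.
\<close>

lemma same_kind_False:
  assumes k1: "has_kind q lam1 w1 U1 \<kappa>" and k2: "has_kind q lam2 w2 U2 \<kappa>"
  shows False
proof -
  have ne: "lam1 \<noteq> lam2" if "U1 k l \<noteq> 0" "U2 k' l \<noteq> 0" "w1 k' = w1 k" "w2 k' = w2 k" for k k' l
    using common_entry[OF that] lam1 by (auto simp: power2_eq_square)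
  have sq: "lam1 = lam2" if "lam1 * q^n = 1" "lam2 * q^n = 1" for n
    using that q by (metis mult_cancel_right power_not_zero)
  note all = supported_on_def all_letters
  show False
  proof (cases \<kappa>)
    case Column_Shift
    then show False
      using k1 k2 ne[of LB LA LB] ne[of LA LB LA] comp_expanded[of LA LA] sq[of 2] xi
      by (auto elim!: has_kind.cases simp: all simp del: split_paired_All)
  next
    case Row_Shift
    then show False
      using k1 k2 ne[of LC LA LC] ne[of LA LC LA] comp_expanded[of LA LA] sq[of 2] xi
      by (auto elim!: has_kind.cases simp: all simp del: split_paired_All)
  next
    case Corner
    then show False
      using k1 k2 ne[of LD LA LD] ne[of LA LD LA] comp_expanded[of LA LA] sq[of 4] xi
      by (auto elim!: has_kind.cases simp: all simp del: split_paired_All)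
  next
    case From_A
    then show False
      using k1 k2 ne[of LB LA LB] ne[of LB LA LC] ne[of LC LA LB] ne[of LC LA LC]
      by (auto elim!: has_kind.cases)
  next
    case From_D
    then show False
      using k1 k2 ne[of LB LD LB] ne[of LB LD LC] ne[of LC LD LB] ne[of LC LD LC] sq[of 2]
      by (auto elim!: has_kind.cases)
  qed
qed

text \<open>
  Let \<open>s = x\<^sub>2\<close> be the shift. As \<open>x\<^sub>1 s\<close> kills \<open>A\<close>, the component of \<open>x\<^sub>1(A)\<close> that \<open>s\<close> does not kill must
  vanish. If \<open>s\<close> maps \<open>B\<close> or \<open>C\<close> back to \<open>A\<close>, then \<open>s x\<^sub>1\<close> kills this generator, so \<open>x\<^sub>1 s\<close> must do so as
  well and the other component vanishes, too.
\<close>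

lemma shift_from_A:
  assumes k1: "has_kind q lam1 w1 U1 From_A"
  shows "has_kind q lam2 w2 U2 Column_Shift \<Longrightarrow> U1 LC LA = 0"
    and "has_kind q lam2 w2 U2 Row_Shift \<Longrightarrow> U1 LB LA = 0"
  using k1 comp_expanded[of LA LA] comp_expanded[of LD LA] comp_expanded[of LB LB]
     comp_expanded[of LC LB] comp_expanded[of LB LC] comp_expanded[of LC LC] xi
  by (auto elim!: has_kind.cases simp: supported_on_def all_letters simp del: split_paired_All)

lemma shift_from_D:
  assumes k1: "has_kind q lam1 w1 U1 From_D"
  shows "has_kind q lam2 w2 U2 Column_Shift \<Longrightarrow> U1 LB LD = 0"
    and "has_kind q lam2 w2 U2 Row_Shift \<Longrightarrow> U1 LC LD = 0"
  using k1 comp_expanded[of LA LD] comp_expanded[of LD LD] comp_expanded[of LB LB]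
     comp_expanded[of LC LB] comp_expanded[of LB LC] comp_expanded[of LC LC] xi
  by (auto elim!: has_kind.cases simp: supported_on_def all_letters simp del: split_paired_All)

text \<open>
  Here \<open>x\<^sub>2\<close> kills \<open>A\<close>, whereas \<open>x\<^sub>2 x\<^sub>1\<close> does not if \<open>x\<^sub>1\<close> maps \<open>A\<close> to \<open>D\<close>.
\<close>

lemma corner_from_D:
  assumes "has_kind q lam1 w1 U1 Corner" "has_kind q lam2 w2 U2 From_D"
  shows "U1 LD LA = 0"
  using assms comp_expanded[of LB LA] comp_expanded[of LC LA] xi
  by (auto elim!: has_kind.cases simp: supported_on_def all_letters simp del: split_paired_All)

lemma corner_from_A:
  assumes "has_kind q lam1 w1 U1 Corner" "has_kind q lam2 w2 U2 From_A"
  shows "U1 LA LD = 0"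
  using assms comp_expanded[of LB LD] comp_expanded[of LC LD] xi
  by (auto elim!: has_kind.cases simp: supported_on_def all_letters simp del: split_paired_All)

end

lemma has_kind_From_A_nonzero: "has_kind q lam w U From_A \<Longrightarrow> U LB LA \<noteq> 0 \<or> U LC LA \<noteq> 0"
  and has_kind_From_D_nonzero: "has_kind q lam w U From_D \<Longrightarrow> U LB LD \<noteq> 0 \<or> U LC LD \<noteq> 0"
  and has_kind_Corner_nonzero: "has_kind q lam w U Corner \<Longrightarrow> U LD LA \<noteq> 0 \<or> U LA LD \<noteq> 0"
  by (auto elim: has_kind.cases)

text \<open>
  Each kind occurs at most once. Three triples of kinds are impossible: a map from \<open>A\<close> (or from \<open>D\<close>)
  into the span of \<open>B, C\<close> would lose both components next to shifts of both types, and a corner map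
  would lose its defining entry next to maps from \<open>A\<close> and from \<open>D\<close>. A set of four kinds omits only one
  kind, so it contains one of these triples.
\<close>

lemma pairwise_skew_bound:
  fixes q :: "'k::field" and U :: "nat \<Rightarrow> 2 \<times> 2 \<Rightarrow> 2 \<times> 2 \<Rightarrow> 'k"
  assumes kind: "\<And>i. i \<in> {1..n} \<Longrightarrow> \<exists>\<kappa>. has_kind q (lam i) (w i) (U i) \<kappa>"
    and pair: "\<And>i j. i \<in> {1..n} \<Longrightarrow> j \<in> {1..n} \<Longrightarrow> i \<noteq> j \<Longrightarrow>
      skew_pair q (xi i j) (lam i) (lam j) (w i) (w j) (U i) (U j)"
  shows "n \<le> 3"
proof -
  obtain \<kappa> where \<kappa>: "\<And>i. i \<in> {1..n} \<Longrightarrow> has_kind q (lam i) (w i) (U i) (\<kappa> i)"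
    using kind by metis
  have inj: "inj_on \<kappa> {1..n}"
  proof (rule inj_onI, rule ccontr)
    fix i j assume i: "i \<in> {1..n}" "j \<in> {1..n}" "\<kappa> i = \<kappa> j" "i \<noteq> j"
    show False
      using skew_pair.same_kind_False[OF pair[OF i(1,2,4)] \<kappa>[OF i(1)]] \<kappa>[OF i(2)] i(3) by simp
  qed
  let ?K = "\<kappa> ` {1..n}"
  have no_A: "\<not> {From_A, Column_Shift, Row_Shift} \<subseteq> ?K"
  proof
    assume "{From_A, Column_Shift, Row_Shift} \<subseteq> ?K"
    then obtain a c r where i: "a \<in> {1..n}" "c \<in> {1..n}" "r \<in> {1..n}" 
      and e: "\<kappa> a = From_A" "\<kappa> c = Column_Shift" "\<kappa> r = Row_Shift" by force
    have p: "skew_pair q (xi a c) (lam a) (lam c) (w a) (w c) (U a) (U c)"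
      "skew_pair q (xi a r) (lam a) (lam r) (w a) (w r) (U a) (U r)"
      using i e by (auto intro!: pair)
    show False
      using skew_pair.shift_from_A(1)[OF p(1)] skew_pair.shift_from_A(2)[OF p(2)]
        \<kappa>[OF i(1)] \<kappa>[OF i(2)] \<kappa>[OF i(3)] has_kind_From_A_nonzero e by metis
  qed
  have no_D: "\<not> {From_D, Column_Shift, Row_Shift} \<subseteq> ?K"
  proof
    assume "{From_D, Column_Shift, Row_Shift} \<subseteq> ?K"
    then obtain a c r where i: "a \<in> {1..n}" "c \<in> {1..n}" "r \<in> {1..n}" 
      and e: "\<kappa> a = From_D" "\<kappa> c = Column_Shift" "\<kappa> r = Row_Shift" by force
    have p: "skew_pair q (xi a c) (lam a) (lam c) (w a) (w c) (U a) (U c)"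
      "skew_pair q (xi a r) (lam a) (lam r) (w a) (w r) (U a) (U r)"
      using i e by (auto intro!: pair)
    show False
      using skew_pair.shift_from_D(1)[OF p(1)] skew_pair.shift_from_D(2)[OF p(2)]
        \<kappa>[OF i(1)] \<kappa>[OF i(2)] \<kappa>[OF i(3)] has_kind_From_D_nonzero e by metis
  qed
  have no_AD: "\<not> {From_A, From_D, Corner} \<subseteq> ?K"
  proof
    assume "{From_A, From_D, Corner} \<subseteq> ?K"
    then obtain a d c where i: "a \<in> {1..n}" "d \<in> {1..n}" "c \<in> {1..n}" 
      and e: "\<kappa> a = From_A" "\<kappa> d = From_D" "\<kappa> c = Corner" by force
    have p: "skew_pair q (xi c a) (lam c) (lam a) (w c) (w a) (U c) (U a)"
      "skew_pair q (xi c d) (lam c) (lam d) (w c) (w d) (U c) (U d)"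
      using i e by (auto intro!: pair)
    show False
      using skew_pair.corner_from_A[OF p(1)] skew_pair.corner_from_D[OF p(2)]
        \<kappa>[OF i(1)] \<kappa>[OF i(2)] \<kappa>[OF i(3)] has_kind_Corner_nonzero e by metis
  qed
  have "card S \<le> 3" if "\<not> {From_A, Column_Shift, Row_Shift} \<subseteq> S" "\<not> {From_D, Column_Shift, Row_Shift} \<subseteq> S"
    "\<not> {From_A, From_D, Corner} \<subseteq> S" for S
  proof -
    (* If at most one kind were missing from S, one of the three triples would be contained in S. *)
    let ?all = "{Column_Shift, Row_Shift, Corner, From_A, From_D}"
    have all: "S \<subseteq> ?all" using skew_kind.exhaust by blast
    have "\<exists>x y. x \<noteq> y \<and> x \<notin> S \<and> y \<notin> S" using that by auto
    then obtain x y where xy: "x \<noteq> y" "x \<notin> S" "y \<notin> S" by blast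
    have "card S \<le> card (?all - {x, y})" using all xy by (intro card_mono) auto
    also have "\<dots> = 3" using xy(1) by (cases x; cases y) (simp_all add: card_Diff_subset)
    finally show ?thesis .
  qed
  then have "card ?K \<le> 3" using no_A no_D no_AD by blast
  then show ?thesis using card_image[OF inj] by simp
qed

section \<open>The bound on the rank\<close>

theorem theorem4p8:
  fixes q :: "'k :: {alg_closed_field, field_char_0}"
    and G :: "('g, 'z) monoid_scheme"
    and \<theta> :: nat
    and g :: "nat \<Rightarrow> 'g"
    and chi :: "nat \<Rightarrow> 'g \<Rightarrow> 'k"
    and \<Delta> :: "('g bos_gen list \<Rightarrow>\<^sub>0 'k) set \<Rightarrow>
               (('g bos_gen list \<Rightarrow>\<^sub>0 'k) set \<times> ('g bos_gen list \<Rightarrow>\<^sub>0 'k) set \<Rightarrow>\<^sub>0 'k) set"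
    and \<epsilon> :: "('g bos_gen list \<Rightarrow>\<^sub>0 'k) set \<Rightarrow> 'k"
    and act :: "('g bos_gen list \<Rightarrow>\<^sub>0 'k) set \<Rightarrow> ((2 \<times> 2) list \<Rightarrow>\<^sub>0 'k) set \<Rightarrow>
                ((2 \<times> 2) list \<Rightarrow>\<^sub>0 'k) set"
  assumes "q \<noteq> 0" "q \<noteq> 1" "q \<noteq> - 1"
    and "bosonization G \<theta> g chi \<Delta> \<epsilon>"
    and "\<And>i. i \<in> {1..\<theta>} \<Longrightarrow> qls_order g chi i \<noteq> 2"
    and "module_algebra (bos_alg G \<theta> g chi) \<Delta> \<epsilon> (oqm2 q) act"
    and "\<And>i. i \<in> {1..\<theta>} \<Longrightarrow>
           restrict (act (bos_grp G \<theta> g chi (g i))) (carrier (oqm2 q)) \<in> oqm2_torus_transp q"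
    and "\<And>i. i \<in> {1..\<theta>} \<Longrightarrow>
           act (bos_x G \<theta> g chi i) ` oqm2_linear_span q \<subseteq> oqm2_linear_span q"
    and "\<And>i. i \<in> {1..\<theta>} \<Longrightarrow>
           \<exists>a\<in>carrier (oqm2 q). act (bos_x G \<theta> g chi i) a \<noteq> \<zero>\<^bsub>oqm2 q\<^esub>"
  shows "\<theta> \<le> 3"
proof -
  define B where "B = bos_alg G \<theta> g chi"
  define x where "x = bos_x G \<theta> g chi"
  define \<gamma> where "\<gamma> i = bos_grp G \<theta> g chi (g i)" for i
  define lam where "lam i = chi i (g i)" for i
  note act = assms(6)[folded B_def]
  have q: "q^2 \<noteq> 1" using assms(2,3) by (simp add: power2_eq_1_iff)
  have G: "comm_group G"
    and gG: "\<And>i. i \<in> {1..\<theta>} \<Longrightarrow> g i \<in> carrier G"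
    and chi: "\<And>i. i \<in> {1..\<theta>} \<Longrightarrow> chi i \<in> hom G mult_group"
    and ord2: "\<And>i. i \<in> {1..\<theta>} \<Longrightarrow> qls_order g chi i \<ge> 2"
    and chi_inv: "\<And>i j. i \<in> {1..\<theta>} \<Longrightarrow> j \<in> {1..\<theta>} \<Longrightarrow> i \<noteq> j \<Longrightarrow> chi i (g j) = inverse (chi j (g i))"
    using conjunct1[OF assms(4)[unfolded bosonization_def]] unfolding qls_datum_def by blast+
  have H: "k_algebra B" and \<Delta>x: "\<And>i. i \<in> {1..\<theta>} \<Longrightarrow> \<Delta> (x i) =
      pure_tensor B B (\<gamma> i) (x i) \<oplus>\<^bsub>tensor_algebra B B\<^esub> pure_tensor B B (x i) \<one>\<^bsub>B\<^esub>"
    using conjunct2[OF assms(4)[unfolded bosonization_def]]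
    unfolding Let_def hopf_algebra_def B_def x_def \<gamma>_def by blast+
  have chi_carrier: "chi i (g j) \<in> carrier mult_group" if "i \<in> {1..\<theta>}" "j \<in> {1..\<theta>}" for i j
    using chi[OF that(1)] gG[OF that(2)] by (auto simp: hom_def)
  have chi_nz: "chi i (g j) \<noteq> 0" if "i \<in> {1..\<theta>}" "j \<in> {1..\<theta>}" for i j
    using chi_carrier[OF that] by (auto simp: units_of_def Units_def ring_of_type_algebra_def)
  have lam: "lam i \<noteq> 1" "(lam i)\<^sup>2 \<noteq> 1" if "i \<in> {1..\<theta>}" for i
    using mult_group_order_gt_2[OF chi_carrier[OF that that]] ord2[OF that] assms(5)[OF that]
    by (simp_all add: qls_order_def lam_def)
  note rel = bos_relations[OF G, where \<theta> = \<theta> and g = g and chi = chi, folded B_def x_def]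
  have \<gamma>B: "\<gamma> i \<in> carrier B" if "i \<in> {1..\<theta>}" for i
    using rel(1)[OF gG[OF that]] by (simp add: \<gamma>_def)
  have xB: "x i \<in> carrier B" if "i \<in> {1..\<theta>}" for i using rel(2)[OF that] .
  have \<gamma>x: "\<gamma> i \<otimes>\<^bsub>B\<^esub> x j = chi j (g i) \<odot>\<^bsub>B\<^esub> (x j \<otimes>\<^bsub>B\<^esub> \<gamma> i)" if "i \<in> {1..\<theta>}" "j \<in> {1..\<theta>}" for i j
    using rel(3)[OF gG[OF that(1)] that(2)] by (simp add: \<gamma>_def)
  have xx: "x i \<otimes>\<^bsub>B\<^esub> x j = chi j (g i) \<odot>\<^bsub>B\<^esub> (x j \<otimes>\<^bsub>B\<^esub> x i)"
    if "i \<in> {1..\<theta>}" "j \<in> {1..\<theta>}" "i \<noteq> j" for i j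
    using rel(4)[OF that] .
  have R: "k_algebra (oqm2 q)" using act by (simp add: module_algebra_def)
  interpret R: ring "oqm2 q" using R by (simp add: k_algebra_def)
  interpret B: ring B using H by (simp add: k_algebra_def)
  have lin: "act h \<in> lin_map (oqm2 q) (oqm2 q)" if "h \<in> carrier B" for h
    using act that by (simp add: module_algebra_def)
  have act_comm: "act h (act h' a) = c \<odot>\<^bsub>oqm2 q\<^esub> act h' (act h a)"
    if "h \<in> carrier B" "h' \<in> carrier B" "h \<otimes>\<^bsub>B\<^esub> h' = c \<odot>\<^bsub>B\<^esub> (h' \<otimes>\<^bsub>B\<^esub> h)" "a \<in> carrier (oqm2 q)" for h h' c a
  proof -
    have comp: "act (k \<otimes>\<^bsub>B\<^esub> k') a = act k (act k' a)" if "k \<in> carrier B" "k' \<in> carrier B" for k k'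
      using act that \<open>a \<in> carrier (oqm2 q)\<close> by (simp add: module_algebra_def)
    have "(\<lambda>h. act h a) \<in> lin_map B (oqm2 q)" using act that(4) by (simp add: module_algebra_def)
    then have "act (c \<odot>\<^bsub>B\<^esub> (h' \<otimes>\<^bsub>B\<^esub> h)) a = c \<odot>\<^bsub>oqm2 q\<^esub> act (h' \<otimes>\<^bsub>B\<^esub> h) a"
      using that by (simp add: lin_map_def)
    then show ?thesis using that by (simp flip: comp)
  qed
  define diagonal where "diagonal w k v = w k * of_bool (k = v)" for w :: "2 \<times> 2 \<Rightarrow> 'k" and k v
  have diagonal_sums: "(\<Sum>m\<in>UNIV. diagonal w k m * f m) = w k * f k"
    "(\<Sum>m\<in>UNIV. f m * diagonal w m k) = f k * w k" for w k f
  proof -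
    have "(\<Sum>m\<in>UNIV. diagonal w k m * f m) = (\<Sum>m\<in>UNIV. if m = k then w k * f k else 0)"
      unfolding diagonal_def by (intro sum.cong refl) auto
    then show "(\<Sum>m\<in>UNIV. diagonal w k m * f m) = w k * f k" by simp
    have "(\<Sum>m\<in>UNIV. f m * diagonal w m k) = (\<Sum>m\<in>UNIV. if m = k then f k * w k else 0)"
      unfolding diagonal_def by (intro sum.cong refl) auto
    then show "(\<Sum>m\<in>UNIV. f m * diagonal w m k) = f k * w k" by simp
  qed
  define matrices where "matrices i w U \<longleftrightarrow>
      (\<forall>v. act (\<gamma> i) (oqm2_lin q (delta v)) = oqm2_lin q (\<lambda>k. diagonal w k v)) \<and>
      (\<forall>v. act (x i) (oqm2_lin q (delta v)) = oqm2_lin q (\<lambda>k. U k v)) \<and> (\<forall>k. w k \<noteq> 0) \<and>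
      (\<exists>\<kappa>. has_kind q (lam i) w U \<kappa>)" for i w U
  have "\<exists>w U. matrices i w U" if i: "i \<in> {1..\<theta>}" for i
  proof -
    note x = xB[OF i] and \<gamma> = \<gamma>B[OF i]
    obtain \<sigma> w where \<sigma>: "\<sigma> = id \<or> \<sigma> = prod.swap" and w: "\<And>v. w v \<noteq> 0" "w LA * w LD = w LB * w LC"
      and \<gamma>Y: "\<And>v. restrict (act (\<gamma> i)) (carrier (oqm2 q)) (oqm2_lin q (delta v)) =
        oqm2_lin q (\<lambda>k. w k * of_bool (k = \<sigma> v))"
      and \<gamma>1: "restrict (act (\<gamma> i)) (carrier (oqm2 q)) \<one>\<^bsub>oqm2 q\<^esub> = \<one>\<^bsub>oqm2 q\<^esub>"
      by (rule torus_transp_on_letters[OF assms(7)[OF i, folded \<gamma>_def] assms(1) q]) (rule that)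
    define W where "W k v = w k * of_bool (k = \<sigma> v)" for k v
    have W: "act (\<gamma> i) (oqm2_lin q (delta v)) = oqm2_lin q (\<lambda>k. W k v)" for v
      using \<gamma>Y[of v] by (simp add: W_def)
    have "\<exists>c. act (x i) (oqm2_lin q (delta v)) = oqm2_lin q c" for v
      unfolding x_def
      by (rule oqm2_linear_span(1)[OF R subsetD[OF assms(8)[OF i] imageI[OF oqm2_linear_span(2)[OF R]]]])
    then obtain c where c: "\<And>v. act (x i) (oqm2_lin q (delta v)) = oqm2_lin q (c v)" by metis
    define U where "U k v = c v k" for k v
    have U: "act (x i) (oqm2_lin q (delta v)) = oqm2_lin q (\<lambda>k. U k v)" for v
      by (simp add: c U_def)
    have skew: "act (x i) (a \<otimes>\<^bsub>oqm2 q\<^esub> b) =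
        (act (\<gamma> i) a \<otimes>\<^bsub>oqm2 q\<^esub> act (x i) b) \<oplus>\<^bsub>oqm2 q\<^esub> (act (x i) a \<otimes>\<^bsub>oqm2 q\<^esub> b)"
      if "a \<in> carrier (oqm2 q)" "b \<in> carrier (oqm2 q)" for a b
      by (rule skew_primitive_acts[OF act H x \<gamma> \<Delta>x[OF i] that])
    have "act (x i) \<one>\<^bsub>oqm2 q\<^esub> = \<zero>\<^bsub>oqm2 q\<^esub>"
      using skew_primitive_kills_one[OF act H x \<gamma> \<gamma>x[OF i i]] lam(1)[OF i] \<gamma>1 by (simp add: lam_def)
    then have nonzero: "\<exists>k v. U k v \<noteq> 0"
    proof (rule contrapos_pp)
      assume "\<not> (\<exists>k v. U k v \<noteq> 0)"
      then have "U k v = 0" for k v by blast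
      then have zero: "act (x i) (oqm2_lin q (delta v)) = \<zero>\<^bsub>oqm2 q\<^esub>" for v
        unfolding U by (simp add: oqm2_lin_def lin_poly_def oqm2_quot oqm2.zero_Q)
      show "act (x i) \<one>\<^bsub>oqm2 q\<^esub> \<noteq> \<zero>\<^bsub>oqm2 q\<^esub>"
      proof
        assume one: "act (x i) \<one>\<^bsub>oqm2 q\<^esub> = \<zero>\<^bsub>oqm2 q\<^esub>"
        have "act (x i) a = \<zero>\<^bsub>oqm2 q\<^esub>" if "a \<in> carrier (oqm2 q)" for a
          by (rule skew_map_eq_0[OF lin[OF x] lin[OF \<gamma>] skew one zero R that])
        then show False using assms(9)[OF i] unfolding x_def by blast
      qed
    qed
    have "act (x i) (oqm2_lin q (delta u) \<otimes>\<^bsub>oqm2 q\<^esub> oqm2_lin q (delta v)) =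
        oqm2_quad q (\<lambda>k l. W k u * U l v + U k u * of_bool (l = v))" for u v
      using skew[OF oqm2_lin_closed[of q "delta u"] oqm2_lin_closed[of q "delta v"]]
      unfolding U W oqm2_lin_mult oqm2_quad_add .
    from linear_oqm2_quad_zero[OF lin[OF x] this]
    have deriv: "skew_derivation q W U"
      unfolding skew_derivation_def skew_image_def by blast
    have weight: "(\<Sum>m\<in>UNIV. W k m * U m l) = lam i * (\<Sum>m\<in>UNIV. U k m * W m l)" for k l
      unfolding lam_def
      by (rule linear_maps_commutation[OF lin[OF \<gamma>] lin[OF x] W U act_comm[OF \<gamma> x \<gamma>x[OF i i]]])
    (* A transposing g would kill the matrix of x. *)
    have "\<sigma> = id"
    proof (rule ccontr)
      assume "\<sigma> \<noteq> id"
      then have W_swap: "W k v = w k * of_bool (k = prod.swap v)" for k v using \<sigma> by (simp add: W_def)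
      have "w k * U (prod.swap k) l = lam i * (U k (prod.swap l) * w (prod.swap l))" for k l
      proof -
        have "(\<Sum>m\<in>UNIV. W k m * U m l) = (\<Sum>m\<in>UNIV. if m = prod.swap k then w k * U (prod.swap k) l else 0)"
          unfolding W_swap by (intro sum.cong refl) auto
        then have left: "(\<Sum>m\<in>UNIV. W k m * U m l) = w k * U (prod.swap k) l" by simp
        have "(\<Sum>m\<in>UNIV. U k m * W m l) =
            (\<Sum>m\<in>UNIV. if m = prod.swap l then U k (prod.swap l) * w (prod.swap l) else 0)"
          unfolding W_swap by (intro sum.cong refl) auto
        then have right: "(\<Sum>m\<in>UNIV. U k m * W m l) = U k (prod.swap l) * w (prod.swap l)" by simp
        show ?thesis using weight[of k l] unfolding left right .
      qed
      from twisted_skew_derivation_eq_0[OF assms(1) q deriv[unfolded W_swap] w(1) this lam[OF i]]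
      show False using nonzero by blast
    qed
    then have W_diag: "W = diagonal w" by (simp add: W_def diagonal_def fun_eq_iff)
    have weight': "w k = lam i * w l" if "U k l \<noteq> 0" for k l
    proof -
      have "w k * U k l = lam i * (U k l * w l)"
        using weight[of k l] unfolding W_diag diagonal_sums .
      then have "w k * U k l = (lam i * w l) * U k l" by (simp only: mult_ac)
      then show ?thesis using that by (simp only: mult_cancel_right simp_thms)
    qed
    have "skew_derivation q (\<lambda>k v. w k * of_bool (k = v)) U"
      using deriv unfolding W_diag diagonal_def .
    then have "\<exists>\<kappa>. has_kind q (lam i) w U \<kappa>"
      by (rule diagonal_skew_derivation_kind[OF assms(1) q _ w weight' lam[OF i] nonzero])
    then have "matrices i w U" using W U w(1) unfolding W_diag matrices_def by (intro conjI allI)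
    then show ?thesis by blast
  qed
  then obtain w U where mat: "matrices i (w i) (U i)" if "i \<in> {1..\<theta>}" for i
    by metis
  have W: "act (\<gamma> i) (oqm2_lin q (delta v)) = oqm2_lin q (\<lambda>k. diagonal (w i) k v)" if "i \<in> {1..\<theta>}" for i v
    using mat[OF that] unfolding matrices_def by (elim conjE) (erule spec)
  have U: "act (x i) (oqm2_lin q (delta v)) = oqm2_lin q (\<lambda>k. U i k v)" if "i \<in> {1..\<theta>}" for i v
    using mat[OF that] unfolding matrices_def by (elim conjE) (erule spec)
  have w: "w i k \<noteq> 0" if "i \<in> {1..\<theta>}" for i k
    using mat[OF that] unfolding matrices_def by (elim conjE) (erule spec)
  have kind: "\<exists>\<kappa>. has_kind q (lam i) (w i) (U i) \<kappa>" if "i \<in> {1..\<theta>}" for i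
    using mat[OF that] unfolding matrices_def by (elim conjE)
  have weight: "w i k = chi j (g i) * w i l" if "i \<in> {1..\<theta>}" "j \<in> {1..\<theta>}" "U j k l \<noteq> 0" for i j k l
  proof -
    have "(\<Sum>m\<in>UNIV. diagonal (w i) k m * U j m l) = chi j (g i) * (\<Sum>m\<in>UNIV. U j k m * diagonal (w i) m l)"
      by (rule linear_maps_commutation[OF lin[OF \<gamma>B[OF that(1)]] lin[OF xB[OF that(2)]]
          W[OF that(1)] U[OF that(2)] act_comm[OF \<gamma>B[OF that(1)] xB[OF that(2)] \<gamma>x[OF that(1,2)]]])
    then have "w i k * U j k l = chi j (g i) * (U j k l * w i l)"
      unfolding diagonal_sums .
    then have "w i k * U j k l = (chi j (g i) * w i l) * U j k l" by (simp only: mult_ac)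
    then show ?thesis using that(3) by (simp only: mult_cancel_right simp_thms)
  qed
  show ?thesis
  proof (rule pairwise_skew_bound[OF kind])
    fix i j assume ij: "i \<in> {1..\<theta>}" "j \<in> {1..\<theta>}" "i \<noteq> j"
    show "skew_pair q (chi j (g i)) (lam i) (lam j) (w i) (w j) (U i) (U j)"
    proof
      show "chi j (g i) * w j k = w j l" if "U i k l \<noteq> 0" for k l
        unfolding weight[OF ij(2,1) that] chi_inv[OF ij] mult.assoc[symmetric]
          right_inverse[OF chi_nz[OF ij(2,1)]] by (rule mult_1_left)
      show "(\<Sum>m\<in>UNIV. U i k m * U j m l) = chi j (g i) * (\<Sum>m\<in>UNIV. U j k m * U i m l)" for k l
        by (rule linear_maps_commutation[OF lin[OF xB[OF ij(1)]] lin[OF xB[OF ij(2)]] U[OF ij(1)] U[OF ij(2)]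
            act_comm[OF xB[OF ij(1)] xB[OF ij(2)] xx[OF ij]]])
      show "w i k = lam i * w i l" if "U i k l \<noteq> 0" for k l
        unfolding lam_def by (rule weight[OF ij(1,1) that])
      show "w j k = lam j * w j l" if "U j k l \<noteq> 0" for k l
        unfolding lam_def by (rule weight[OF ij(2,2) that])
      show "w i k = chi j (g i) * w i l" if "U j k l \<noteq> 0" for k l
        by (rule weight[OF ij(1,2) that])
    qed (rule assms(1) chi_nz[OF ij(2,1)] w[OF ij(1)] w[OF ij(2)] lam(2)[OF ij(1)])+
  qed
qed

end
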